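(* Let $y:=(u,v)^\top$ be a solution on $\mathbb R$ of the Goldstein--Taylor equation (with relaxation coefficient $\sigma=1$) $$\partial_tu(t,x)=-\partial_xv(t,x),\qquad\partial_tv(t,x)=-\partial_xu(t,x)-v(t,x),\qquad x\in\mathbb R,\ t\ge0,$$ with initial datum $y_0:=(u_0,v_0)^\top$ such that $u_0,v_0\in\mathrm L^1(\mathbb R)\cap\mathrm L^2(\mathbb R)$. Let $\mu(\xi):=\mathrm{Re}\big(\frac12-\sqrt{\frac14-\xi^2}\big)$. Then, for any $t\ge0$, $$\|y(t)\|^2_{\mathrm L^2(\mathbb R)}\le\inf_{0<R<\frac12}\frac{1+2R}{1-2R}\left(2\min\Big\{\frac{B(t,R)}{\sqrt t},R\Big\}\|y_0\|_{\mathrm L^1(\mathbb R)}^2+e^{-2\mu(R)t}\,\|y_0\|^2_{\mathrm L^2(\mathbb R)}\right),$$ with $B(t,R):=\sqrt t\int_0^Re^{-2\mu(s)t}\,ds\in\big[0,\sqrt{\pi/8}\,\big)$.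
   Context: For vector-valued $y=(u,v)^\top$, norms are $\|y\|_{\mathrm L^p(\mathbb R)}=\big(\int_{\mathbb R}|y(x)|^p\,dx\big)^{1/p}$ with $|\cdot|$ the Euclidean norm. At $t=0$ the quantity $B(t,R)/\sqrt t$ is understood as $\int_0^Re^{-2\mu(s)t}ds=R$. *)

theory Defs
  imports "HOL-Analysis.Analysis"
begin

definition in_Lp :: "real \<Rightarrow> (real \<Rightarrow> 'a::real_normed_vector) \<Rightarrow> bool" where
  "in_Lp p f \<longleftrightarrow> f \<in> borel_measurable lborel \<and> integrable lborel (\<lambda>x. norm (f x) powr p)"

text \<open>For \<open>f :: real \<Rightarrow> real \<times> real\<close> the pointwise norm is the Euclidean one,
  \<open>norm (a, b) = sqrt (a\<^sup>2 + b\<^sup>2)\<close>. The value is meaningful only if \<open>in_Lp p f\<close>,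
  since a non-integrable function has Bochner integral \<open>0\<close>.\<close>

definition Lp_norm :: "real \<Rightarrow> (real \<Rightarrow> 'a::real_normed_vector) \<Rightarrow> real" where
  "Lp_norm p f = (LBINT x. norm (f x) powr p) powr (1 / p)"

definition test_fun :: "(real \<Rightarrow> real) \<Rightarrow> bool" where
  "test_fun \<phi> \<longleftrightarrow> \<phi> C1_differentiable_on UNIV \<and> compact (closure {x. \<phi> x \<noteq> 0})"

text \<open>The initial datum is only in \<open>L\<^sup>2\<close>, so a solution is a mild one: a curve that is
  continuous from \<open>[0,\<infinity>)\<close> into \<open>L\<^sup>2\<close>, takes the initial datum (as an element of \<open>L\<^sup>2\<close>),
  and satisfies the system integrated in time, with the spatial derivative moved to
  test functions.\<close>

definition GT_solution ::
  "(real \<Rightarrow> real \<Rightarrow> real) \<Rightarrow> (real \<Rightarrow> real \<Rightarrow> real) \<Rightarrow> (real \<Rightarrow> real) \<Rightarrow> (real \<Rightarrow> real) \<Rightarrow> bool" where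
  "GT_solution u v u0 v0 \<longleftrightarrow>
     (\<forall>t\<ge>0. in_Lp 2 (u t) \<and> in_Lp 2 (v t)) \<and>
     (\<forall>t\<ge>0. ((\<lambda>s. Lp_norm 2 (\<lambda>x. (u s x, v s x) - (u t x, v t x))) \<longlongrightarrow> 0) (at t within {0..})) \<and>
     (AE x in lborel. u 0 x = u0 x \<and> v 0 x = v0 x) \<and>
     (\<forall>\<phi>. test_fun \<phi> \<longrightarrow> (\<forall>t\<ge>0.
        (LBINT x. u t x * \<phi> x) - (LBINT x. u0 x * \<phi> x)
          = (LBINT s:{0..t}. (LBINT x. v s x * deriv \<phi> x)) \<and>
        (LBINT x. v t x * \<phi> x) - (LBINT x. v0 x * \<phi> x)
          = (LBINT s:{0..t}. ((LBINT x. u s x * deriv \<phi> x) - (LBINT x. v s x * \<phi> x)))))"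

text \<open>\<open>csqrt\<close> is the principal branch, so \<open>mu \<xi> = 1/2\<close> for \<open>\<bar>\<xi>\<bar> \<ge> 1/2\<close>.\<close>

definition mu :: "real \<Rightarrow> real" where
  "mu \<xi> = Re (1 / 2 - csqrt (1 / 4 - (complex_of_real \<xi>)\<^sup>2))"

definition B :: "real \<Rightarrow> real \<Rightarrow> real" where
  "B t R = sqrt t * (LBINT s:{0..R}. exp (- 2 * mu s * t))"

text \<open>The quotient \<open>B t R / sqrt t\<close>, with its conventional value at \<open>t = 0\<close>.\<close>

definition B_quot :: "real \<Rightarrow> real \<Rightarrow> real" where
  "B_quot t R = (if t = 0 then (LBINT s:{0..R}. exp (- 2 * mu s * t)) else B t R / sqrt t)"

lemma B_quot_0: "R \<ge> 0 \<Longrightarrow> B_quot 0 R = R"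
  by (simp add: B_quot_def set_lebesgue_integral_def)

end

theory Submission
  imports Defs "HOL-Probability.Distributions"
begin

text \<open>
  Under the Fourier transform in space the system decouples into damped oscillators, one for each
  frequency \<open>\<xi>\<close>:  \<open>a' = - \<xi> b\<close>,  \<open>b' = \<xi> a - b\<close>. The plain energy \<open>a\<^sup>2 + b\<^sup>2\<close> does not decay at a
  uniform rate because the damping acts on \<open>b\<close> only; subtracting a small multiple of the cross term
  \<open>a b\<close> repairs this. With a suitable coefficient the modified energy decays at the rate
  \<open>2 mu (min \<bar>\<xi>\<bar> R)\<close>, and it differs from the plain energy by factors between \<open>1 - 2 R\<close> and \<open>1 + 2 R\<close>
  (lemma \<open>mode_decay\<close>). Frequencies above \<open>R\<close> thus decay at least like \<open>exp (- 2 mu R t)\<close> and are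
  controlled by the \<open>L\<^sup>2\<close> norm of the datum. Frequencies below \<open>R\<close> decay more slowly, but there the
  transform of the datum is bounded pointwise by the \<open>L\<^sup>1\<close> norm, and integrating the decay factor
  over them gives \<open>B t R / sqrt t\<close>.

  A solution is only square integrable in space, so its transform is not given by an integral. It
  is therefore first multiplied by a cutoff of width \<open>n\<close>. The product solves the same system up to
  a source of \<open>L\<^sup>2\<close> size \<open>O(1 / n)\<close>, carried by the derivative of the cutoff, and this source disappears in
  the limit. The product has bounded support, so it can be expanded in a Fourier series of period
  \<open>2 \<pi> n\<close>, and sums over the frequencies \<open>k / n\<close> take the place of integrals over \<open>\<xi>\<close>. Only finite
  sums occur: Bessel's inequality (\<open>bessel\<close>) for the datum and the source, and completeness
  with an arbitrarily small remainder (\<open>parseval_le\<close>) for the solution at time \<open>t\<close>. Testing the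
  solution with \<open>cos\<close> and \<open>sin\<close> times the cutoff yields the oscillator equations directly from the
  weak formulation (\<open>solution_mode_decay\<close>). The estimates for fixed \<open>n\<close> are collected in
  \<open>cutoff_solution_bound\<close>, and \<open>solution_L2_bound\<close> takes the limit.

  This argument produces the low-frequency term with the constant \<open>1 / \<pi>\<close> of the Plancherel
  identity in place of \<open>2\<close>. The bound on \<open>B\<close> holds because \<open>mu s \<ge> s\<^sup>2\<close>, which compares the
  integrand with a Gaussian.
\<close>

section \<open>The decay rate\<close>

lemma mu_eq_sqrt:
  assumes "0 \<le> s" "s \<le> 1/2"
  shows "mu s = 1/2 - sqrt (1/4 - s\<^sup>2)"
proof -
  have "s\<^sup>2 \<le> (1/2)\<^sup>2"
    using assms by (intro power_mono) auto
  then have "0 \<le> 1/4 - s\<^sup>2"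
    by (simp add: power2_eq_square)
  then have "csqrt (complex_of_real (1/4 - s\<^sup>2)) = complex_of_real (sqrt (1/4 - s\<^sup>2))"
    by (rule csqrt_of_real_nonneg[of "complex_of_real _", simplified])
  then show ?thesis
    by (simp add: mu_def)
qed

text \<open>
  \<open>mu s\<close> is the smaller root of \<open>z\<^sup>2 - z + s\<^sup>2\<close>, the characteristic polynomial of the damped oscillator with
  frequency \<open>s\<close>. All later computations use this equation instead of the square root.
\<close>
lemma mu_root:
  assumes "0 \<le> s" "s \<le> 1/2"
  shows "mu s * (1 - mu s) = s\<^sup>2" "0 \<le> mu s" "mu s \<le> 1/2"
proof -
  have "s\<^sup>2 \<le> (1/2)\<^sup>2"
    using assms by (intro power_mono) auto
  then have nn: "0 \<le> 1/4 - s\<^sup>2"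
    by (simp add: power2_eq_square)
  show "mu s * (1 - mu s) = s\<^sup>2"
    using real_sqrt_pow2[OF nn] unfolding mu_eq_sqrt[OF assms] by (simp add: algebra_simps power2_eq_square)
  have "sqrt (1/4 - s\<^sup>2) \<le> 1/2"
    by (intro real_le_lsqrt) (simp_all add: power2_eq_square)
  then show "0 \<le> mu s" "mu s \<le> 1/2"
    using nn by (auto simp: mu_eq_sqrt[OF assms])
qed

lemma square_le_mu:
  assumes "0 \<le> s" "s \<le> 1/2"
  shows "s\<^sup>2 \<le> mu s"
proof -
  have "mu s * (1 - mu s) \<le> mu s * 1"
    using mu_root[OF assms] by (intro mult_left_mono) auto
  then show ?thesis
    using mu_root(1)[OF assms] by simp
qed

lemma mu_mono:
  assumes "0 \<le> r" "r \<le> s" "s \<le> 1/2"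
  shows "mu r \<le> mu s"
proof -
  have "sqrt (1/4 - s\<^sup>2) \<le> sqrt (1/4 - r\<^sup>2)"
    using assms by (intro real_sqrt_le_mono diff_left_mono power_mono) auto
  then show ?thesis
    using assms by (simp add: mu_eq_sqrt)
qed

lemma continuous_on_mu:
  assumes "R \<le> 1/2"
  shows "continuous_on {0..R} mu"
proof -
  have "continuous_on {0..R} (\<lambda>s. 1/2 - sqrt (1/4 - s\<^sup>2))"
    by (intro continuous_intros)
  then show ?thesis
    using assms by (subst continuous_on_cong[OF refl mu_eq_sqrt]) auto
qed

section \<open>Modified energy of a damped oscillator\<close>

text \<open>
  The modified energy is \<open>a\<^sup>2 + b\<^sup>2 - 2 \<theta> a b\<close>. For \<open>\<bar>\<xi>\<bar> \<le> R\<close> the choice \<open>\<theta> = 2 \<xi>\<close> makes it decay at the exact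
  rate: what is missing from equality is \<open>2 (1 - 2 m) (sqrt m a \<mp> sqrt (1 - m) b)\<^sup>2\<close> with \<open>m = mu \<bar>\<xi>\<bar>\<close>.
  For larger \<open>\<bar>\<xi>\<bar>\<close> only the product \<open>\<theta> \<xi>\<close> enters the two diagonal coefficients, so keeping it
  at the value that it has for \<open>\<bar>\<xi>\<bar> = R\<close> keeps the rate \<open>mu R\<close>, while the cross term, proportional to
  \<open>\<theta>\<close>, only becomes smaller. The sources \<open>g\<close> and \<open>h\<close> cost an arbitrarily small loss \<open>\<eta>\<close> in the rate.
\<close>
lemma mode_decay:
  fixes a b g h :: "real \<Rightarrow> real"
  assumes t: "0 \<le> t" and R: "0 < R" "R < 1/2" and \<eta>: "0 < \<eta>"
    and a: "\<And>s. s \<in> {0..t} \<Longrightarrow> (a has_real_derivative (- \<xi> * b s + g s)) (at s within {0..t})"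
    and b: "\<And>s. s \<in> {0..t} \<Longrightarrow> (b has_real_derivative (\<xi> * a s - b s + h s)) (at s within {0..t})"
    and g: "continuous_on {0..t} g" and h: "continuous_on {0..t} h"
  shows "(1 - 2 * R) * ((a t)\<^sup>2 + (b t)\<^sup>2) \<le> exp (\<eta> * t) * (1 + 2 * R) *
    (exp (- 2 * mu (min \<bar>\<xi>\<bar> R) * t) * ((a 0)\<^sup>2 + (b 0)\<^sup>2)
      + 1 / \<eta> * integral {0..t} (\<lambda>s. (g s)\<^sup>2 + (h s)\<^sup>2))"
proof -
  define \<rho> where "\<rho> = min \<bar>\<xi>\<bar> R"
  define m where "m = mu \<rho>"
  \<comment> \<open>\<open>2 \<xi>\<close> for low frequencies; at \<open>\<xi> = 0\<close> the quotient is \<open>0\<close>, which is the right value.\<close>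
  define \<theta> where "\<theta> = 2 * \<rho>\<^sup>2 / \<xi>"
  define H where "H = (\<lambda>x y. x\<^sup>2 + y\<^sup>2 - 2 * \<theta> * x * y)"
  have \<rho>: "0 \<le> \<rho>" "\<rho> \<le> 1/2" "\<rho> \<le> R" "\<rho> \<le> \<bar>\<xi>\<bar>"
    using R by (auto simp: \<rho>_def)
  have m: "m * (1 - m) = \<rho>\<^sup>2" "0 \<le> m" "m \<le> 1/2"
    using mu_root[OF \<rho>(1,2)] by (auto simp: m_def)
  have \<theta>\<xi>: "\<theta> * \<xi> = 2 * \<rho>\<^sup>2"
    using \<rho> by (cases "\<xi> = 0") (auto simp: \<theta>_def)
  have \<theta>le: "\<bar>\<theta>\<bar> \<le> 2 * \<rho>"
  proof (cases "\<xi> = 0")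
    case False
    have "\<rho> * \<rho> \<le> \<rho> * \<bar>\<xi>\<bar>"
      using \<rho> by (intro mult_left_mono)
    then show ?thesis
      using False \<rho> by (simp add: \<theta>_def abs_mult power2_eq_square field_simps)
  qed (use \<rho> in \<open>simp add: \<theta>_def\<close>)
  have cross: "\<bar>2 * \<theta> * x * y\<bar> \<le> 2 * R * (x\<^sup>2 + y\<^sup>2)" for x y
  proof -
    have "\<bar>2 * \<theta> * x * y\<bar> = \<bar>\<theta>\<bar> * (2 * \<bar>x\<bar> * \<bar>y\<bar>)"
      by (simp add: abs_mult)
    also have "\<dots> \<le> (2 * R) * (x\<^sup>2 + y\<^sup>2)"
      using \<theta>le \<rho> sum_squares_bound[of "\<bar>x\<bar>" "\<bar>y\<bar>"] by (intro mult_mono) auto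
    finally show ?thesis .
  qed
  have H_lower: "(1 - 2 * R) * (x\<^sup>2 + y\<^sup>2) \<le> H x y" for x y
    using cross[of x y] by (simp add: H_def algebra_simps abs_le_iff)
  have H_upper: "H x y \<le> (1 + 2 * R) * (x\<^sup>2 + y\<^sup>2)" for x y
    using cross[of x y] by (simp add: H_def algebra_simps abs_le_iff)
  have H_nonneg: "0 \<le> H x y" for x y
    using order_trans[OF _ H_lower[of x y]] R by simp
  have dissipation: "2 * x * (- \<xi> * y) + 2 * y * (\<xi> * x - y)
      - 2 * \<theta> * ((- \<xi> * y) * y + x * (\<xi> * x - y)) \<le> - 2 * m * H x y" for x y
  proof -
    have "0 \<le> (sqrt m * \<bar>x\<bar> - sqrt (1 - m) * \<bar>y\<bar>)\<^sup>2"
      by simp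
    also have "\<dots> = m * x\<^sup>2 + (1 - m) * y\<^sup>2 - 2 * sqrt (m * (1 - m)) * \<bar>x\<bar> * \<bar>y\<bar>"
      unfolding real_sqrt_mult using m by (simp add: power2_diff power_mult_distrib)
    also have "\<dots> = m * x\<^sup>2 + (1 - m) * y\<^sup>2 - (2 * \<rho>) * \<bar>x * y\<bar>"
      using \<rho> by (simp add: m(1) abs_mult)
    also have "\<dots> \<le> m * x\<^sup>2 + (1 - m) * y\<^sup>2 - \<theta> * (x * y)"
      using mult_right_mono[OF \<theta>le, of "\<bar>x * y\<bar>"] abs_ge_self[of "\<theta> * (x * y)"]
      by (simp add: abs_mult)
    finally have "0 \<le> 2 * (1 - 2 * m) * (m * x\<^sup>2 + (1 - m) * y\<^sup>2 - \<theta> * (x * y))"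
      using m by simp
    moreover have "2 * x * (- \<xi> * y) + 2 * y * (\<xi> * x - y)
        - 2 * \<theta> * ((- \<xi> * y) * y + x * (\<xi> * x - y)) + 2 * m * H x y
        = - 2 * y\<^sup>2 + 2 * (\<theta> * \<xi>) * y\<^sup>2 - 2 * (\<theta> * \<xi>) * x\<^sup>2 + 2 * \<theta> * x * y + 2 * m * H x y"
      by (simp add: algebra_simps power2_eq_square)
    moreover have "\<dots> = - (2 * (1 - 2 * m) * (m * x\<^sup>2 + (1 - m) * y\<^sup>2 - \<theta> * (x * y)))"
      unfolding \<theta>\<xi> m(1)[symmetric] H_def by (simp add: algebra_simps power2_eq_square)
    ultimately show ?thesis by linarith
  qed
  \<comment> \<open>Expanding the modified energy of \<open>(\<eta> x - p, \<eta> y - q)\<close>.\<close>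
  have source: "2 * (x * p + y * q - \<theta> * (p * y + x * q)) \<le> \<eta> * H x y + 1 / \<eta> * H p q" for x y p q
  proof -
    have "0 \<le> H (\<eta> * x - p) (\<eta> * y - q) / \<eta>"
      using H_nonneg \<eta> by simp
    also have "\<dots> = \<eta> * H x y + 1 / \<eta> * H p q - 2 * (x * p + y * q - \<theta> * (p * y + x * q))"
      using \<eta> by (simp add: H_def field_simps power2_eq_square)
    finally show ?thesis by simp
  qed
  define c where "c = 2 * m - \<eta>"
  define G where "G = (\<lambda>s. (g s)\<^sup>2 + (h s)\<^sup>2)"
  define \<kappa> where "\<kappa> = (1 + 2 * R) / \<eta> * exp (2 * m * t)"
  have G: "continuous_on {0..t} G"
    unfolding G_def by (intro continuous_intros g h)
  \<comment> \<open>The integrating factor turns the energy into a nonincreasing quantity once the accumulated source is subtracted;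
    bounding the factor by its largest value \<open>exp (2 m t)\<close> in front of the source keeps the integral simple.\<close>
  define \<Phi> where "\<Phi> = (\<lambda>s. exp (c * s) * H (a s) (b s) - \<kappa> * integral {0..s} G)"
  have "\<Phi> t \<le> \<Phi> 0"
  proof (cases "t = 0")
    case False
    define D where "D = (\<lambda>s. exp (c * s) * (c * H (a s) (b s) + (2 * a s * (- \<xi> * b s + g s)
        + 2 * b s * (\<xi> * a s - b s + h s) - 2 * \<theta> * ((- \<xi> * b s + g s) * b s
        + a s * (\<xi> * a s - b s + h s)))) - \<kappa> * G s)"
    have deriv: "(\<Phi> has_real_derivative D s) (at s within {0..t})" if s: "s \<in> {0..t}" for s
    proof -
      have "((\<lambda>s. integral {0..s} G) has_real_derivative G s) (at s within {0..t})"
        using integral_has_real_derivative[OF G s] .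
      then show ?thesis
        unfolding \<Phi>_def D_def H_def using s
        by (auto intro!: derivative_eq_intros a b simp: algebra_simps power2_eq_square)
    qed
    have D: "D s \<le> 0" if s: "s \<in> {0..t}" for s
    proof -
      let ?x = "a s" and ?y = "b s" and ?p = "g s" and ?q = "h s"
      have "c * H ?x ?y + (2 * ?x * (- \<xi> * ?y + ?p)
        + 2 * ?y * (\<xi> * ?x - ?y + ?q) - 2 * \<theta> * ((- \<xi> * ?y + ?p) * ?y
        + ?x * (\<xi> * ?x - ?y + ?q)))
        = c * H ?x ?y + (2 * ?x * (- \<xi> * ?y) + 2 * ?y * (\<xi> * ?x - ?y)
      - 2 * \<theta> * ((- \<xi> * ?y) * ?y + ?x * (\<xi> * ?x - ?y)))
       + 2 * (?x * ?p + ?y * ?q - \<theta> * (?p * ?y + ?x * ?q))"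
        by (simp add: algebra_simps)
      also have "\<dots> \<le> c * H ?x ?y + - 2 * m * H ?x ?y + (\<eta> * H ?x ?y + 1 / \<eta> * H ?p ?q)"
        by (intro add_mono dissipation source order_refl)
      also have "\<dots> = 1 / \<eta> * H ?p ?q"
        by (simp add: c_def algebra_simps)
      also have "\<dots> \<le> 1 / \<eta> * ((1 + 2 * R) * G s)"
        unfolding G_def using \<eta> H_upper by (intro mult_left_mono) auto
      finally have le: "c * H ?x ?y + (2 * ?x * (- \<xi> * ?y + ?p)
        + 2 * ?y * (\<xi> * ?x - ?y + ?q) - 2 * \<theta> * ((- \<xi> * ?y + ?p) * ?y
        + ?x * (\<xi> * ?x - ?y + ?q))) \<le> (1 + 2 * R) / \<eta> * G s"
        by simp
      have "c * s \<le> 2 * m * t"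
      proof -
        have "c * s \<le> 2 * m * s"
          using s \<eta> by (intro mult_right_mono) (auto simp: c_def)
        also have "\<dots> \<le> 2 * m * t"
          using s m by (intro mult_left_mono) auto
        finally show ?thesis .
      qed
      then have "exp (c * s) * ((1 + 2 * R) / \<eta> * G s) \<le> exp (2 * m * t) * ((1 + 2 * R) / \<eta> * G s)"
        using \<eta> R by (intro mult_right_mono) (auto simp: G_def)
      moreover note mult_left_mono[OF le, of "exp (c * s)"]
      ultimately show ?thesis
        unfolding D_def \<kappa>_def by (simp add: mult_ac)
    qed
    show ?thesis
    proof (rule DERIV_nonpos_imp_decreasing_open[of 0 t])
      show "continuous_on {0..t} \<Phi>"
        using deriv by (meson DERIV_continuous_on)
      fix s assume s: "0 < s" "s < t"
      then have "at s within {0..t} = at s"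
        by (intro at_within_interior) auto
      then show "\<exists>y. DERIV \<Phi> s :> y \<and> y \<le> 0"
        using deriv[of s] D[of s] s by auto
    qed (use t in auto)
  qed auto
  then have "exp (c * t) * H (a t) (b t) \<le> H (a 0) (b 0) + \<kappa> * integral {0..t} G"
    by (simp add: \<Phi>_def)
  also have "\<dots> \<le> (1 + 2 * R) * ((a 0)\<^sup>2 + (b 0)\<^sup>2) + \<kappa> * integral {0..t} G"
    using H_upper by simp
  finally have "exp (- (c * t)) * (exp (c * t) * H (a t) (b t))
      \<le> exp (- (c * t)) * ((1 + 2 * R) * ((a 0)\<^sup>2 + (b 0)\<^sup>2) + \<kappa> * integral {0..t} G)"
    by (intro mult_left_mono) auto
  also have "exp (- (c * t)) * (exp (c * t) * H (a t) (b t)) = H (a t) (b t)"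
    by (simp add: exp_minus field_simps)
  also have "exp (- (c * t)) * ((1 + 2 * R) * ((a 0)\<^sup>2 + (b 0)\<^sup>2) + \<kappa> * integral {0..t} G)
     = exp (\<eta> * t) * (1 + 2 * R) * (exp (- 2 * m * t) * ((a 0)\<^sup>2 + (b 0)\<^sup>2)
      + 1 / \<eta> * integral {0..t} G)"
    unfolding c_def \<kappa>_def
    by (simp add: algebra_simps exp_minus exp_diff exp_add field_simps)
  finally show ?thesis
    using H_lower[of "a t" "b t"] unfolding m_def \<rho>_def G_def by linarith
qed

section \<open>Comparison of the low-frequency integral with a Gaussian\<close>

lemma gaussian_set_integral_le:
  assumes "0 < t" "0 \<le> R"
  shows "(LBINT s:{0..R}. exp (- 2 * s\<^sup>2 * t)) \<le> sqrt (pi / 8) / sqrt t"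
proof -
  \<comment> \<open>Rescaling \<open>x = c s\<close> turns \<open>exp (- 2 s\<^sup>2 t)\<close> into \<open>exp (- x\<^sup>2)\<close>.\<close>
  define c where "c = sqrt (2 * t)"
  have c: "0 < c" "c\<^sup>2 = 2 * t" using assms by (auto simp: c_def)
  have "has_bochner_integral lborel (\<lambda>x. indicator {0..} (0 + c * x) *\<^sub>R exp (- (0 + c * x)\<^sup>2)) ((sqrt pi / 2) /\<^sub>R \<bar>c\<bar>)"
    using c gaussian_moment_0 by (subst lborel_has_bochner_integral_real_affine_iff[symmetric]) auto
  then have *: "has_bochner_integral lborel (\<lambda>x. indicator {0..} x *\<^sub>R exp (- 2 * x\<^sup>2 * t)) (sqrt pi / 2 / c)"
    using c by (simp add: indicator_def zero_le_mult_iff power_mult_distrib field_simps)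
  have "(LBINT s:{0..R}. exp (- 2 * s\<^sup>2 * t)) \<le> (LBINT s:{0..}. exp (- 2 * s\<^sup>2 * t))"
    unfolding set_lebesgue_integral_def
  proof (rule integral_mono)
    show "integrable lborel (\<lambda>x. indicat_real {0..R} x *\<^sub>R exp (- 2 * x\<^sup>2 * t))"
      unfolding set_integrable_def[symmetric]
      by (intro borel_integrable_atLeastAtMost' continuous_intros)
  qed (use * in \<open>auto simp: has_bochner_integral_iff indicator_def\<close>)
  also have "\<dots> = sqrt pi / 2 / c"
    using * by (simp add: set_lebesgue_integral_def has_bochner_integral_iff)
  also have "\<dots> = sqrt (pi / 8) / sqrt t"
  proof -
    have "sqrt 8 = 2 * sqrt 2"
      using real_sqrt_mult[of 4 2] by simp
    then show ?thesis by (simp add: c_def real_sqrt_mult real_sqrt_divide)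
  qed
  finally show ?thesis .
qed

lemma set_integrable_exp_mu:
  assumes "R \<le> 1/2"
  shows "set_integrable lborel {0..R} (\<lambda>s. exp (- 2 * mu s * t))"
  by (intro borel_integrable_atLeastAtMost' continuous_intros continuous_on_mu assms)

text \<open>
  Strictness in the upper bound comes from the part of the Gaussian between \<open>R\<close> and \<open>R + 1\<close>, which the
  integral defining \<open>B\<close> does not reach.
\<close>
lemma B_bounds:
  assumes t: "0 \<le> t" and R: "0 < R" "R < 1/2"
  shows "0 \<le> B t R" "B t R < sqrt (pi / 8)"
proof -
  show "0 \<le> B t R"
    unfolding B_def set_lebesgue_integral_def using t by (auto intro!: mult_nonneg_nonneg integral_nonneg_AE)
  show "B t R < sqrt (pi / 8)"
  proof (cases "t = 0")
    case False
    then have t: "0 < t" using t by simp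
    let ?g = "\<lambda>s. exp (- 2 * s\<^sup>2 * t)"
    have int: "set_integrable lborel {a..b} ?g" for a b
      by (intro borel_integrable_atLeastAtMost' continuous_intros)
    have "(LBINT s:{0..R}. exp (- 2 * mu s * t)) \<le> (LBINT s:{0..R}. ?g s)"
    proof (rule set_integral_mono[OF set_integrable_exp_mu int])
      fix s assume "s \<in> {0..R}"
      then have "s\<^sup>2 * t \<le> mu s * t"
        using R t square_le_mu[of s] by (intro mult_right_mono) auto
      then show "exp (- 2 * mu s * t) \<le> ?g s" by simp
    qed (use R in auto)
    also have "\<dots> < (LBINT s:{0..R+1}. ?g s)"
    proof -
      have "{0..R+1} = {0..R} \<union> {R<..R+1}" using R by auto
      moreover have int2: "set_integrable lborel {R<..R+1} ?g"
        by (rule set_integrable_subset[OF int[of R "R+1"]]) auto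
      moreover have "{0..R} \<inter> {R<..R+1} = {}" by auto
      ultimately have "(LBINT s:{0..R+1}. ?g s) = (LBINT s:{0..R}. ?g s) + (LBINT s:{R<..R+1}. ?g s)"
        using set_integral_Un[OF _ int int2, of 0 R] by simp
      moreover have "(LBINT s:{R<..R+1}. exp (- 2 * (R+1)\<^sup>2 * t)) \<le> (LBINT s:{R<..R+1}. ?g s)"
      proof (rule set_integral_mono[OF _ int2])
        fix s assume "s \<in> {R<..R+1}"
        then have "s\<^sup>2 * t \<le> (R+1)\<^sup>2 * t"
          using R t by (intro mult_right_mono power_mono) auto
        then show "exp (- 2 * (R+1)\<^sup>2 * t) \<le> ?g s" by simp
      qed (simp add: set_integrable_def)
      moreover have "(LBINT s:{R<..R+1}. exp (- 2 * (R+1)\<^sup>2 * t)) = exp (- 2 * (R+1)\<^sup>2 * t)"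
        by (simp add: set_lebesgue_integral_def)
      moreover have "0 < exp (- 2 * (R+1)\<^sup>2 * t)" by simp
      ultimately show ?thesis by linarith
    qed
    also have "\<dots> \<le> sqrt (pi / 8) / sqrt t"
      using gaussian_set_integral_le[OF t] R by simp
    finally show ?thesis
      using t by (simp add: B_def field_simps)
  qed (simp add: B_def)
qed

lemma B_quot_eq_integral:
  assumes "0 \<le> t" "R \<le> 1/2"
  shows "B_quot t R = integral {0..R} (\<lambda>s. exp (- 2 * mu s * t))"
  unfolding set_borel_integral_eq_integral(2)[OF set_integrable_exp_mu[OF assms(2)], symmetric]
  using assms(1) by (simp add: B_quot_def B_def)

lemma B_quot_bounds:
  assumes "0 \<le> t" "0 \<le> R" "R \<le> 1/2"
  shows "0 \<le> B_quot t R" "B_quot t R \<le> R"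
proof -
  have ion: "(\<lambda>s. exp (- 2 * mu s * t)) integrable_on {0..R}"
    using assms by (intro integrable_continuous_real continuous_intros continuous_on_mu)
  show "0 \<le> B_quot t R"
    unfolding B_quot_eq_integral[OF assms(1,3)] by (rule Henstock_Kurzweil_Integration.integral_nonneg[OF ion]) simp
  have "integral {0..R} (\<lambda>s. exp (- 2 * mu s * t)) \<le> integral {0..R} (\<lambda>s. 1)"
    by (rule integral_le[OF ion]) (use assms mu_root(2) in auto)
  then show "B_quot t R \<le> R"
    unfolding B_quot_eq_integral[OF assms(1,3)] using assms by simp
qed

section \<open>Square-integrable functions\<close>

lemma in_Lp_2_iff:
  fixes f :: "real \<Rightarrow> real"
  shows "in_Lp 2 f \<longleftrightarrow> f \<in> borel_measurable borel \<and> integrable lborel (\<lambda>x. (f x)\<^sup>2)"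
  by (simp add: in_Lp_def)

lemma Lp_norm_2_pair:
  fixes f g :: "real \<Rightarrow> real"
  shows "(Lp_norm 2 (\<lambda>x. (f x, g x)))\<^sup>2 = (LBINT x. (f x)\<^sup>2 + (g x)\<^sup>2)"
proof -
  have "0 \<le> (LBINT x. (f x)\<^sup>2 + (g x)\<^sup>2)"
    by (intro integral_nonneg_AE AE_I2) simp
  then show ?thesis
    by (simp add: Lp_norm_def norm_Pair powr_half_sqrt)
qed

lemma integrable_L2_mult:
  fixes f g :: "real \<Rightarrow> real"
  assumes "in_Lp 2 f" "in_Lp 2 g"
  shows "integrable lborel (\<lambda>x. f x * g x)"
proof (rule Bochner_Integration.integrable_bound)
  show "integrable lborel (\<lambda>x. (f x)\<^sup>2 + (g x)\<^sup>2)"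
    using assms by (simp add: in_Lp_2_iff)
  have "\<bar>f x * g x\<bar> \<le> (f x)\<^sup>2 + (g x)\<^sup>2" for x
  proof -
    have "2 * \<bar>f x * g x\<bar> \<le> (f x)\<^sup>2 + (g x)\<^sup>2"
      using sum_squares_bound[of "\<bar>f x\<bar>" "\<bar>g x\<bar>"] by (simp add: abs_mult)
    moreover have "0 \<le> \<bar>f x * g x\<bar>" by simp
    ultimately show ?thesis by linarith
  qed
  then show "AE x in lborel. norm (f x * g x) \<le> norm ((f x)\<^sup>2 + (g x)\<^sup>2)"
    by (intro AE_I2) simp
qed (use assms in \<open>auto simp: in_Lp_2_iff\<close>)

lemma in_Lp_2_diff:
  fixes f g :: "real \<Rightarrow> real"
  assumes "in_Lp 2 f" "in_Lp 2 g"
  shows "in_Lp 2 (\<lambda>x. f x - g x)"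
proof -
  have "integrable lborel (\<lambda>x. ((f x)\<^sup>2 + (g x)\<^sup>2) - 2 * (f x * g x))"
    using assms integrable_L2_mult[OF assms] by (simp add: in_Lp_2_iff)
  moreover have "(f x - g x)\<^sup>2 = ((f x)\<^sup>2 + (g x)\<^sup>2) - 2 * (f x * g x)" for x
    by (simp add: power2_eq_square algebra_simps)
  ultimately have "integrable lborel (\<lambda>x. (f x - g x)\<^sup>2)"
    by (simp only:)
  then show ?thesis
    using assms by (auto simp: in_Lp_2_iff)
qed

lemma in_Lp_2_mult_bounded:
  fixes f \<psi> :: "real \<Rightarrow> real"
  assumes f: "in_Lp 2 f" and \<psi>: "continuous_on UNIV \<psi>" "\<And>x. \<bar>\<psi> x\<bar> \<le> C"
  shows "in_Lp 2 (\<lambda>x. \<psi> x * f x)" and "(LBINT x. (\<psi> x * f x)\<^sup>2) \<le> C\<^sup>2 * (LBINT x. (f x)\<^sup>2)"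
proof -
  have [measurable]: "f \<in> borel_measurable borel" "\<psi> \<in> borel_measurable borel"
    using f \<psi>(1) by (auto simp: in_Lp_2_iff intro: borel_measurable_continuous_onI)
  have le: "(\<psi> x * f x)\<^sup>2 \<le> C\<^sup>2 * (f x)\<^sup>2" for x
  proof -
    have "(\<psi> x)\<^sup>2 \<le> C\<^sup>2" using \<psi>(2)[of x] by (metis abs_ge_zero power2_abs power_mono)
    then show ?thesis by (simp add: power_mult_distrib mult_right_mono)
  qed
  have int: "integrable lborel (\<lambda>x. C\<^sup>2 * (f x)\<^sup>2)"
    using f by (simp add: in_Lp_2_iff)
  have "integrable lborel (\<lambda>x. (\<psi> x * f x)\<^sup>2)"
    by (rule Bochner_Integration.integrable_bound[OF int]) (use le in auto)
  then show "in_Lp 2 (\<lambda>x. \<psi> x * f x)" by (simp add: in_Lp_2_iff)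
  have "(LBINT x. (\<psi> x * f x)\<^sup>2) \<le> (LBINT x. C\<^sup>2 * (f x)\<^sup>2)"
    by (intro integral_mono int le) fact
  then show "(LBINT x. (\<psi> x * f x)\<^sup>2) \<le> C\<^sup>2 * (LBINT x. (f x)\<^sup>2)" by simp
qed

lemma L2_Cauchy_Schwarz:
  fixes f g :: "real \<Rightarrow> real"
  assumes f: "in_Lp 2 f" and g: "in_Lp 2 g"
  shows "(LBINT x. f x * g x)\<^sup>2 \<le> (LBINT x. (f x)\<^sup>2) * (LBINT x. (g x)\<^sup>2)"
proof -
  define F G P where "F = (LBINT x. (f x)\<^sup>2)" "G = (LBINT x. (g x)\<^sup>2)" "P = (LBINT x. f x * g x)"
  note int = integrable_L2_mult[OF f g] f[unfolded in_Lp_2_iff] g[unfolded in_Lp_2_iff]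
  have nn: "0 \<le> F - 2 * l * P + l\<^sup>2 * G" for l
  proof -
    have "0 \<le> (LBINT x. (f x - l * g x)\<^sup>2)"
      by (intro integral_nonneg_AE AE_I2) simp
    also have "\<dots> = (LBINT x. (f x)\<^sup>2 - 2 * l * (f x * g x) + l\<^sup>2 * (g x)\<^sup>2)"
      by (intro Bochner_Integration.integral_cong) (auto simp: power2_eq_square algebra_simps)
    also have "\<dots> = F - 2 * l * P + l\<^sup>2 * G"
      using int by (simp add: F_G_P_def)
    finally show ?thesis .
  qed
  have G: "0 \<le> G" unfolding F_G_P_def by (intro integral_nonneg_AE AE_I2) simp
  show ?thesis
    unfolding F_G_P_def[symmetric]
  proof (cases "G = 0")
    case True
    have "P = 0"
    proof (rule ccontr)
      assume "P \<noteq> 0"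
      \<comment> \<open>This argument makes the quadratic in \<open>l\<close> equal to \<open>- 1\<close>.\<close>
      then show False using nn[of "(F + 1) / (2 * P)"] True by simp
    qed
    then show "P\<^sup>2 \<le> F * G" using True by simp
  next
    case False
    then have "0 < G" using G by simp
    then show "P\<^sup>2 \<le> F * G"
      using nn[of "P / G"] by (simp add: field_simps power2_eq_square)
  qed
qed

text \<open>
  A measurable function is almost everywhere a limit of continuous functions. Clamping these to the
  range of \<open>f\<close> gives a common bound, so that dominated convergence applies on a bounded interval.
\<close>
lemma bounded_L2_approx:
  fixes f :: "real \<Rightarrow> real"
  assumes f: "f \<in> borel_measurable borel" "\<And>x. \<bar>f x\<bar> \<le> M" and e: "0 < e"
  obtains g where "continuous_on UNIV g" "\<And>x. \<bar>g x\<bar> \<le> M" "(LBINT x:{a..b}. (f x - g x)\<^sup>2) < e"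
proof -
  have "f \<in> borel_measurable (lebesgue_on UNIV)"
    using measurable_completion[of f lborel borel] f(1) by (simp add: lebesgue_on_UNIV_eq)
  then have "f measurable_on UNIV"
    by (subst measurable_on_iff_borel_measurable) auto
  then obtain N g where N: "negligible N" and g: "\<And>n. continuous_on UNIV (g n)"
    and lim: "\<And>x. x \<notin> N \<Longrightarrow> (\<lambda>n. g n x) \<longlonglongrightarrow> f x"
    unfolding measurable_on_def by auto
  have M: "0 \<le> M" using f(2)[of 0] by linarith
  define q where "q = (\<lambda>n x. max (-M) (min M (g n x)))"
  have q: "continuous_on UNIV (q n)" "\<bar>q n x\<bar> \<le> M" for n x
    unfolding q_def using M by (auto intro!: continuous_intros g)
  have qlim: "(\<lambda>n. q n x) \<longlonglongrightarrow> f x" if "x \<notin> N" for x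
  proof -
    have "(\<lambda>n. q n x) \<longlonglongrightarrow> max (-M) (min M (f x))"
      unfolding q_def by (intro tendsto_intros lim that)
    moreover have "max (-M) (min M (f x)) = f x"
      using f(2)[of x] by auto
    ultimately show ?thesis by simp
  qed
  have meas: "q n \<in> borel_measurable borel" for n
    using q(1) by (rule borel_measurable_continuous_onI)
  have "(\<lambda>n. LBINT x:{a..b}. (f x - q n x)\<^sup>2) \<longlonglongrightarrow> (LBINT x:{a..b}. (0::real))"
    unfolding set_lebesgue_integral_def
  proof (rule integral_dominated_convergence)
    show "integrable lborel (\<lambda>x. indicator {a..b} x *\<^sub>R (2 * M)\<^sup>2)"
      by (intro integrable_scaleR_left integrable_real_indicator) (auto simp: emeasure_lborel_Icc_eq)
    have "AE x in lborel. x \<notin> N"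
      using N by (metis AE_not_in completion.AE_iff_null_sets lborel_def  negligible_iff_null_sets null_sets_completion_iff AE_completion_iff)
    then show "AE x in lborel. (\<lambda>n. indicat_real {a..b} x *\<^sub>R (f x - q n x)\<^sup>2) \<longlonglongrightarrow> indicat_real {a..b} x *\<^sub>R 0"
    proof eventually_elim
      case (elim x)
      have "(\<lambda>n. indicat_real {a..b} x *\<^sub>R (f x - q n x)\<^sup>2) \<longlonglongrightarrow> indicat_real {a..b} x *\<^sub>R (f x - f x)\<^sup>2"
        by (intro tendsto_intros qlim elim)
      then show ?case by simp
    qed
    show "AE x in lborel. norm (indicat_real {a..b} x *\<^sub>R (f x - q n x)\<^sup>2) \<le> indicat_real {a..b} x *\<^sub>R (2 * M)\<^sup>2" for n
    proof (rule AE_I2)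
      fix x
      have "\<bar>f x - q n x\<bar> \<le> 2 * M"
        using f(2)[of x] q(2)[of n x] by linarith
      then have "(f x - q n x)\<^sup>2 \<le> (2 * M)\<^sup>2"
        by (metis abs_ge_zero power2_abs power_mono)
      then show "norm (indicat_real {a..b} x *\<^sub>R (f x - q n x)\<^sup>2) \<le> indicat_real {a..b} x *\<^sub>R (2 * M)\<^sup>2"
        by (simp add: indicator_def)
    qed
  qed (use f(1) meas in measurable)
  then have "eventually (\<lambda>n. (LBINT x:{a..b}. (f x - q n x)\<^sup>2) < e) sequentially"
    using e by (intro order_tendstoD(2)) (auto simp: set_lebesgue_integral_def)
  then obtain n where "(LBINT x:{a..b}. (f x - q n x)\<^sup>2) < e"
    by (meson eventually_sequentially order_refl)
  then show thesis using that q by blast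
qed

text \<open>
  Cutting off the values of \<open>f\<close> at height \<open>n\<close> changes it little in \<open>L\<^sup>2\<close> and reduces to the bounded case.
\<close>
lemma L2_approx:
  fixes f :: "real \<Rightarrow> real"
  assumes f: "f \<in> borel_measurable borel" "integrable lborel (\<lambda>x. (f x)\<^sup>2)" and e: "0 < e"
  obtains g M where "continuous_on UNIV g" "\<And>x. \<bar>g x\<bar> \<le> M" "(LBINT x:{a..b}. (f x - g x)\<^sup>2) < e"
proof -
  define k where "k = (\<lambda>n x. max (- real n) (min (real n) (f x)))"
  have [measurable]: "f \<in> borel_measurable borel" "k n \<in> borel_measurable borel" for n
    using f(1) unfolding k_def by auto
  have kf: "(f x - k n x)\<^sup>2 \<le> (f x)\<^sup>2" for n x
  proof -
    have "\<bar>f x - k n x\<bar> \<le> \<bar>f x\<bar>" by (auto simp: k_def)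
    then show ?thesis by (metis abs_ge_zero power2_abs power_mono)
  qed
  have "(\<lambda>n. LBINT x. (f x - k n x)\<^sup>2) \<longlonglongrightarrow> (LBINT (x::real). (0::real))"
  proof (rule integral_dominated_convergence[where w="\<lambda>x. (f x)\<^sup>2"])
    show "AE x in lborel. (\<lambda>n. (f x - k n x)\<^sup>2) \<longlonglongrightarrow> 0"
    proof (rule AE_I2)
      fix x
      have "eventually (\<lambda>n. (f x - k n x)\<^sup>2 = 0) sequentially"
        using eventually_ge_at_top[of "nat \<lceil>\<bar>f x\<bar>\<rceil>"]
      proof eventually_elim
        case (elim n)
        then have "\<bar>f x\<bar> \<le> real n" by linarith
        then show ?case by (auto simp: k_def)
      qed
      then show "(\<lambda>n. (f x - k n x)\<^sup>2) \<longlonglongrightarrow> 0"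
        by (rule tendsto_eventually)
    qed
  qed (use kf f(2) in auto)
  then have "eventually (\<lambda>n. (LBINT x. (f x - k n x)\<^sup>2) < e / 4) sequentially"
    using e by (intro order_tendstoD(2)) auto
  then obtain n where n: "(LBINT x. (f x - k n x)\<^sup>2) < e / 4"
    by (meson eventually_sequentially order_refl)
  have kn: "\<bar>k n x\<bar> \<le> real n" for x by (auto simp: k_def)
  obtain g where g: "continuous_on UNIV g" "\<And>x. \<bar>g x\<bar> \<le> real n" "(LBINT x:{a..b}. (k n x - g x)\<^sup>2) < e / 4"
    using bounded_L2_approx[of "k n" "real n" "e / 4" a b] kn e by auto
  have [measurable]: "g \<in> borel_measurable borel"
    using g(1) by (rule borel_measurable_continuous_onI)
  have ifk: "integrable lborel (\<lambda>x. (f x - k n x)\<^sup>2)"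
    by (rule Bochner_Integration.integrable_bound[OF f(2)]) (use kf in auto)
  have ikg: "integrable lborel (\<lambda>x. indicat_real {a..b} x *\<^sub>R (k n x - g x)\<^sup>2)"
  proof (rule Bochner_Integration.integrable_bound)
    show "integrable lborel (\<lambda>x. indicator {a..b} x *\<^sub>R (2 * real n)\<^sup>2)"
      by (intro integrable_scaleR_left integrable_real_indicator) (auto simp: emeasure_lborel_Icc_eq)
    show "AE x in lborel. norm (indicat_real {a..b} x *\<^sub>R (k n x - g x)\<^sup>2) \<le> norm (indicat_real {a..b} x *\<^sub>R (2 * real n)\<^sup>2)"
    proof (rule AE_I2)
      fix x
      have "\<bar>k n x - g x\<bar> \<le> 2 * real n"
        using kn[of x] g(2)[of x] by linarith
      then have "(k n x - g x)\<^sup>2 \<le> (2 * real n)\<^sup>2"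
        by (metis abs_ge_zero power2_abs power_mono)
      then show "norm (indicat_real {a..b} x *\<^sub>R (k n x - g x)\<^sup>2) \<le> norm (indicat_real {a..b} x *\<^sub>R (2 * real n)\<^sup>2)"
        by (simp add: indicator_def)
    qed
  qed simp
  have "(LBINT x:{a..b}. (f x - g x)\<^sup>2) \<le> (LBINT x. 2 * (f x - k n x)\<^sup>2 + 2 * (indicat_real {a..b} x *\<^sub>R (k n x - g x)\<^sup>2))"
    unfolding set_lebesgue_integral_def
  proof (rule integral_mono_AE')
    show "integrable lborel (\<lambda>x. 2 * (f x - k n x)\<^sup>2 + 2 * (indicat_real {a..b} x *\<^sub>R (k n x - g x)\<^sup>2))"
      using ifk ikg by simp
    have "(f x - g x)\<^sup>2 \<le> 2 * (f x - k n x)\<^sup>2 + 2 * (k n x - g x)\<^sup>2" for x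
      using sum_squares_bound[of "f x - k n x" "k n x - g x"] by (simp add: power2_eq_square algebra_simps)
    then show "AE x in lborel. indicat_real {a..b} x *\<^sub>R (f x - g x)\<^sup>2 \<le> 2 * (f x - k n x)\<^sup>2 + 2 * (indicat_real {a..b} x *\<^sub>R (k n x - g x)\<^sup>2)"
      by (auto simp: indicator_def)
  qed auto
  also have "\<dots> = 2 * (LBINT x. (f x - k n x)\<^sup>2) + 2 * (LBINT x:{a..b}. (k n x - g x)\<^sup>2)"
    unfolding set_lebesgue_integral_def using ifk ikg by simp
  also have "\<dots> < e" using n g(3) by linarith
  finally show thesis using that g by blast
qed

section \<open>Density of trigonometric polynomials\<close>

definition trig_poly :: "(real \<Rightarrow> complex) \<Rightarrow> bool" where
  "trig_poly p \<longleftrightarrow> (\<exists>S a. finite (S::int set) \<and> p = (\<lambda>\<theta>. \<Sum>k\<in>S. a k * cis (real_of_int k * \<theta>)))"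

lemma trig_poly_monom: "trig_poly (\<lambda>\<theta>. c * cis (real_of_int k * \<theta>))"
  unfolding trig_poly_def by (rule exI[of _ "{k}"], rule exI[of _ "\<lambda>_. c"]) auto

lemma trig_poly_add:
  assumes "trig_poly p" "trig_poly q"
  shows "trig_poly (\<lambda>\<theta>. p \<theta> + q \<theta>)"
proof -
  obtain S a where S: "finite (S::int set)" and p: "p = (\<lambda>\<theta>. \<Sum>k\<in>S. a k * cis (real_of_int k * \<theta>))"
    using assms(1) unfolding trig_poly_def by blast
  obtain T b where T: "finite (T::int set)" and q: "q = (\<lambda>\<theta>. \<Sum>k\<in>T. b k * cis (real_of_int k * \<theta>))"
    using assms(2) unfolding trig_poly_def by blast
  have eq: "(\<Sum>k\<in>U. f k * e k) = (\<Sum>k\<in>U \<union> V. (if k \<in> U then f k else 0) * e k)"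
    if "finite U" "finite V" for U V :: "int set" and f e :: "int \<Rightarrow> complex"
    using that by (intro sum.mono_neutral_cong_left) auto
  have "p \<theta> + q \<theta> = (\<Sum>k\<in>S \<union> T. ((if k \<in> S then a k else 0) + (if k \<in> T then b k else 0)) * cis (real_of_int k * \<theta>))" for \<theta>
    unfolding p q distrib_right sum.distrib
    using eq[OF S T, of a] eq[OF T S, of b] by (simp add: Un_commute)
  then show ?thesis
    unfolding trig_poly_def using S T by (intro exI[of _ "S \<union> T"] exI conjI ext) auto
qed

lemma trig_poly_sum:
  assumes "\<And>i. i \<in> I \<Longrightarrow> trig_poly (p i)"
  shows "trig_poly (\<lambda>\<theta>. \<Sum>i\<in>I. p i \<theta>)"
  using assms
proof (induction I rule: infinite_finite_induct)
  case (insert i I)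
  then show ?case by (simp add: trig_poly_add)
qed (use trig_poly_monom[of 0 0] in auto)

lemma trig_poly_mult:
  assumes "trig_poly p" "trig_poly q"
  shows "trig_poly (\<lambda>\<theta>. p \<theta> * q \<theta>)"
proof -
  obtain S a where S: "finite (S::int set)" and p: "p = (\<lambda>\<theta>. \<Sum>k\<in>S. a k * cis (real_of_int k * \<theta>))"
    using assms(1) unfolding trig_poly_def by blast
  obtain T b where T: "finite (T::int set)" and q: "q = (\<lambda>\<theta>. \<Sum>k\<in>T. b k * cis (real_of_int k * \<theta>))"
    using assms(2) unfolding trig_poly_def by blast
  have "p \<theta> * q \<theta> = (\<Sum>k\<in>S. \<Sum>l\<in>T. (a k * b l) * cis (real_of_int (k + l) * \<theta>))" for \<theta>
    by (simp add: p q sum_product cis_mult distrib_right distrib_left mult_ac mult.left_commute[of "cis _"])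
  then show ?thesis
    by (simp only:) (intro trig_poly_sum trig_poly_monom)
qed

text \<open>
  On the unit circle the coordinates are \<open>(z + 1/z) / 2\<close> and \<open>(z - 1/z) / (2 \<i>)\<close>, so polynomials in them are
  trigonometric polynomials.
\<close>
lemma trig_poly_of_circle_polynomial:
  fixes f :: "complex \<Rightarrow> real"
  assumes "real_polynomial_function f"
  shows "trig_poly (\<lambda>\<theta>. complex_of_real (f (cis \<theta>)))"
  using assms
proof (induction rule: real_polynomial_function.induct)
  case (linear f)
  interpret bounded_linear f by fact
  have "f (cis \<theta>) = cos \<theta> * f 1 + sin \<theta> * f \<i>" for \<theta>
  proof -
    have "cis \<theta> = cos \<theta> *\<^sub>R 1 + sin \<theta> *\<^sub>R \<i>"
      by (simp add: complex_eq_iff)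
    then show ?thesis by (simp add: add scaleR)
  qed
  then have "complex_of_real (f (cis \<theta>)) = (of_real (f 1) / 2 - \<i> * of_real (f \<i>) / 2) * cis (real_of_int 1 * \<theta>)
     + (of_real (f 1) / 2 + \<i> * of_real (f \<i>) / 2) * cis (real_of_int (-1) * \<theta>)" for \<theta>
    by (simp add: complex_eq_iff)
  then show ?case
    by (simp only:) (intro trig_poly_add trig_poly_monom)
next
  case (const c)
  then show ?case using trig_poly_monom[of "of_real c" 0] by simp
qed (simp_all add: trig_poly_add trig_poly_mult)

text \<open>
  A function that vanishes near the ends of \<open>[-\<pi>, \<pi>]\<close> is a continuous function on the unit circle, where
  the Stone-Weierstrass theorem applies.
\<close>
lemma trig_poly_dense:
  fixes h :: "real \<Rightarrow> real"
  assumes h: "continuous_on UNIV h" and supp: "\<And>x. 3/2 \<le> \<bar>x\<bar> \<Longrightarrow> h x = 0" and e: "0 < e"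
  obtains p where "trig_poly p" "\<And>x. x \<in> {-pi<..pi} \<Longrightarrow> norm (complex_of_real (h x) - p x) < e"
proof -
  let ?S = "sphere (0::complex) 1"
  \<comment> \<open>\<open>Arg\<close> jumps at \<open>- 1\<close>. The circle is split into an arc away from \<open>- 1\<close>, where \<open>Arg\<close> is continuous,
    and an arc around \<open>- 1\<close>, where \<open>h \<circ> Arg\<close> vanishes.\<close>
  have S: "?S = {z\<in>?S. cos (3/2) \<le> Re z} \<union> {z\<in>?S. Re z \<le> cos (3/2)}" by auto
  have cos1: "0 < cos (3/2::real)"
    using pi_gt3 by (intro cos_gt_zero_pi) auto
  have Arg_far: "h (Arg z) = 0" if "z \<in> ?S" "Re z \<le> cos (3/2)" for z
  proof (rule supp)
    show "3/2 \<le> \<bar>Arg z\<bar>"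
    proof (rule ccontr)
      assume "\<not> 3/2 \<le> \<bar>Arg z\<bar>"
      then have "cos (3/2) < cos \<bar>Arg z\<bar>"
        using pi_gt3 by (intro cos_monotone_0_pi) auto
      moreover have "z \<noteq> 0" using that by auto
      then have "cos (Arg z) = Re z"
        using that by (simp add: cos_Arg)
      ultimately show False using that by simp
    qed
  qed
  have "continuous_on ?S (\<lambda>z. h (Arg z))"
  proof (subst S, rule continuous_on_closed_Un)
    show "closed {z\<in>?S. cos (3/2) \<le> Re z}" "closed {z\<in>?S. Re z \<le> cos (3/2)}"
      by (auto intro!: closed_Collect_conj closed_Collect_le closed_Collect_eq continuous_intros simp: sphere_def)
    show "continuous_on {z\<in>?S. cos (3/2) \<le> Re z} (\<lambda>z. h (Arg z))"
    proof (rule continuous_on_compose2[OF h])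
      show "continuous_on {z\<in>?S. cos (3/2) \<le> Re z} Arg"
        using cos1 by (intro continuous_at_imp_continuous_on ballI continuous_at_Arg)
          (auto simp: complex_nonpos_Reals_iff)
    qed auto
    show "continuous_on {z\<in>?S. Re z \<le> cos (3/2)} (\<lambda>z. h (Arg z))"
      by (subst continuous_on_cong[where g="\<lambda>_. 0"]) (use Arg_far in auto)
  qed
  then obtain g where g: "real_polynomial_function g" "\<And>z. z \<in> ?S \<Longrightarrow> \<bar>h (Arg z) - g z\<bar> < e"
    using Stone_Weierstrass_real_polynomial_function[of ?S "\<lambda>z. h (Arg z)" e] e by auto
  show thesis
  proof (rule that[OF trig_poly_of_circle_polynomial[OF g(1)]])
    fix x assume "x \<in> {-pi<..pi}"
    then have "Arg (cis x) = x"
      by (simp add: Arg_cis)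
    then show "norm (complex_of_real (h x) - complex_of_real (g (cis x))) < e"
      using g(2)[of "cis x"] by (simp flip: of_real_diff)
  qed
qed

section \<open>Fourier series of functions of bounded support\<close>

definition cos_transform :: "real \<Rightarrow> (real \<Rightarrow> real) \<Rightarrow> real" where
  "cos_transform \<xi> f = (LBINT x. f x * cos (\<xi> * x))"

definition sin_transform :: "real \<Rightarrow> (real \<Rightarrow> real) \<Rightarrow> real" where
  "sin_transform \<xi> f = (LBINT x. f x * sin (\<xi> * x))"

lemma integrable_of_bounded_support:
  fixes f :: "real \<Rightarrow> real"
  assumes f: "f \<in> borel_measurable borel" "integrable lborel (\<lambda>x. (f x)\<^sup>2)"
    and supp: "\<And>x. L \<le> \<bar>x\<bar> \<Longrightarrow> f x = 0"
  shows "integrable lborel f"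
proof (rule Bochner_Integration.integrable_bound)
  have "integrable lborel (indicat_real {-L..L})"
    by (intro integrable_real_indicator) (auto simp: emeasure_lborel_Icc_eq)
  then show "integrable lborel (\<lambda>x. indicat_real {-L..L} x + (f x)\<^sup>2)"
    using f(2) by simp
  have "\<bar>f x\<bar> \<le> 1 + (f x)\<^sup>2" for x
    using sum_squares_bound[of 1 "\<bar>f x\<bar>"] by simp
  then show "AE x in lborel. norm (f x) \<le> norm (indicat_real {-L..L} x + (f x)\<^sup>2)"
    using supp by (intro AE_I2) (auto simp: indicator_def not_le abs_le_iff abs_less_iff)
qed (use f in simp)

text \<open>
  Orthogonality of the characters of period \<open>2 \<pi> L\<close>.
\<close>
lemma integral_cis:
  fixes m :: int
  assumes "0 < L"
  shows "(LBINT x:{-pi*L..pi*L}. cis (real_of_int m * (x / L))) = (if m = 0 then of_real (2 * pi * L) else 0)"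
proof (cases "m = 0")
  case False
  define F where "F = (\<lambda>x. cis (real_of_int m * (x / L)) * (of_real L / (\<i> * of_int m)))"
  have "(LBINT x. indicator {-pi*L..pi*L} x *\<^sub>R cis (real_of_int m * (x / L))) = F (pi*L) - F (-pi*L)"
  proof (rule integral_FTC_Icc)
    show "-pi*L \<le> pi*L" using assms by simp
    show "(F has_vector_derivative cis (real_of_int m * (x / L))) (at x within {-pi*L..pi*L})" for x
    proof -
      have "DERIV (\<lambda>z. exp (\<i> * (of_int m * (z / of_real L))) * (of_real L / (\<i> * of_int m))) (of_real x)
          :> exp (\<i> * (of_int m * (of_real x / of_real L))) * (\<i> * (of_int m * (1 / of_real L))) * (of_real L / (\<i> * of_int m))"
        using assms by (auto intro!: derivative_eq_intros simp: mult_ac)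
      then have "((\<lambda>x. exp (\<i> * (of_int m * (of_real x / of_real L))) * (of_real L / (\<i> * of_int m)))
          has_vector_derivative exp (\<i> * (of_int m * (of_real x / of_real L))) * (\<i> * (of_int m * (1 / of_real L))) * (of_real L / (\<i> * of_int m))) (at x within {-pi*L..pi*L})"
        by (rule has_vector_derivative_real_field)
      moreover have "exp (\<i> * (of_int m * (of_real x / of_real L))) * (\<i> * (of_int m * (1 / of_real L))) * (of_real L / (\<i> * of_int m))
         = cis (real_of_int m * (x / L))"
        using False assms by (simp add: cis_conv_exp)
      ultimately show ?thesis by (simp add: F_def cis_conv_exp)
    qed
    show "continuous_on {-pi*L..pi*L} (\<lambda>x. cis (real_of_int m * (x / L)))"
      using assms by (intro continuous_intros) auto
  qed
  also have "F (pi*L) - F (-pi*L) = 0"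
  proof -
    have "sin (real_of_int m * pi) = 0"
      by (metis mult.commute sin_npi_int)
    then have "cis (real_of_int m * pi) = cis (- (real_of_int m * pi))"
      by (simp add: complex_eq_iff)
    then show ?thesis using assms by (simp add: F_def)
  qed
  finally show ?thesis using False by (simp add: set_lebesgue_integral_def)
qed (use assms in \<open>simp add: set_lebesgue_integral_def scaleR_conv_of_real measure_def emeasure_lborel_Icc_eq\<close>)

text \<open>
  Completing the square in each coefficient. The best choice \<open>cnj (c k) / (2 \<pi> L)\<close> removes the
  first term in the sum and gives Bessel's inequality; the other choices show that
  no trigonometric polynomial with frequencies in \<open>S\<close> does better, which gives completeness.
\<close>
lemma trig_approximation_error:
  fixes f :: "real \<Rightarrow> real" and a :: "int \<Rightarrow> complex"
  assumes f: "f \<in> borel_measurable borel" "integrable lborel (\<lambda>x. (f x)\<^sup>2)"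
    and L: "0 < L" and supp: "\<And>x. L \<le> \<bar>x\<bar> \<Longrightarrow> f x = 0" and S: "finite S"
  defines "c \<equiv> \<lambda>k. Complex (cos_transform (real_of_int k / L) f) (sin_transform (real_of_int k / L) f)"
  shows "(LBINT x:{-pi*L..pi*L}. (norm (of_real (f x) - (\<Sum>k\<in>S. a k * cis (real_of_int k * (x / L)))))\<^sup>2)
    = (LBINT x. (f x)\<^sup>2) + (\<Sum>k\<in>S. 2 * pi * L * (norm (a k - cnj (c k) / of_real (2 * pi * L)))\<^sup>2
        - (norm (c k))\<^sup>2 / (2 * pi * L))"
proof -
  let ?I = "indicat_real {-pi*L..pi*L}"
  define p where "p = (\<lambda>x. \<Sum>k\<in>S. a k * cis (real_of_int k * (x / L)))"
  have fint: "integrable lborel f"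
    by (rule integrable_of_bounded_support[OF f supp])
  have I1: "?I x = 1" if "f x \<noteq> 0" for x
  proof -
    have "\<bar>x\<bar> < L" using that supp[of x] by linarith
    moreover have "L < pi * L" using L pi_gt3 by simp
    ultimately show ?thesis by (auto simp: indicator_def)
  qed
  have fcis: "integrable lborel (\<lambda>x. of_real (f x) * cis (\<xi> * x))" for \<xi>
  proof (rule Bochner_Integration.integrable_bound[OF fint])
    have [measurable]: "(\<lambda>x. cis (\<xi> * x)) \<in> borel_measurable borel"
      by (intro borel_measurable_continuous_onI continuous_intros)
    show "(\<lambda>x. complex_of_real (f x) * cis (\<xi> * x)) \<in> borel_measurable lborel"
      using f(1) by measurable
  qed (simp add: norm_mult)
  have c: "(LBINT x. of_real (f x) * cis (\<xi> * x)) = Complex (cos_transform \<xi> f) (sin_transform \<xi> f)" for \<xi>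
    using integral_Re[OF fcis[of \<xi>]] integral_Im[OF fcis[of \<xi>]]
    by (simp add: complex_eq_iff cos_transform_def sin_transform_def)
  have cisI: "integrable lborel (\<lambda>x. ?I x *\<^sub>R cis (real_of_int k * (x / L)))" for k
    unfolding set_integrable_def[symmetric] using L
    by (intro borel_integrable_atLeastAtMost' continuous_intros) auto
  have fp: "integrable lborel (\<lambda>x. of_real (f x) * p x)"
    "(LBINT x. of_real (f x) * p x) = (\<Sum>k\<in>S. a k * c k)"
  proof -
    have eq: "of_real (f x) * p x = (\<Sum>k\<in>S. a k * (of_real (f x) * cis (real_of_int k / L * x)))" for x
      by (simp add: p_def sum_distrib_left mult_ac)
    show "integrable lborel (\<lambda>x. of_real (f x) * p x)"
      unfolding eq by (intro Bochner_Integration.integrable_sum integrable_mult_right fcis)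
    have "(LBINT x. of_real (f x) * p x) = (\<Sum>k\<in>S. LBINT x. a k * (of_real (f x) * cis (real_of_int k / L * x)))"
      unfolding eq by (intro Bochner_Integration.integral_sum integrable_mult_right fcis)
    also have "\<dots> = (\<Sum>k\<in>S. a k * (LBINT x. of_real (f x) * cis (real_of_int k / L * x)))"
      by (intro sum.cong refl integral_mult_right_zero)
    finally show "(LBINT x. of_real (f x) * p x) = (\<Sum>k\<in>S. a k * c k)"
      unfolding c c_def .
  qed
  have pp: "integrable lborel (\<lambda>x. ?I x *\<^sub>R (p x * cnj (p x)))"
    "(LBINT x. ?I x *\<^sub>R (p x * cnj (p x))) = of_real (2 * pi * L * (\<Sum>k\<in>S. (norm (a k))\<^sup>2))"
  proof -
    have "p x * cnj (p x) = (\<Sum>j\<in>S. \<Sum>k\<in>S. (a j * cnj (a k)) * (cis (real_of_int j * (x/L)) * cis (- (real_of_int k * (x/L)))))" for x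
      by (simp add: p_def sum_product cis_cnj mult_ac)
    also have "\<dots> x = (\<Sum>j\<in>S. \<Sum>k\<in>S. (a j * cnj (a k)) * cis (real_of_int (j - k) * (x/L)))" for x
      by (simp add: cis_mult algebra_simps)
    finally have eq: "?I x *\<^sub>R (p x * cnj (p x)) = (\<Sum>j\<in>S. \<Sum>k\<in>S. (a j * cnj (a k)) * (?I x *\<^sub>R cis (real_of_int (j - k) * (x/L))))" for x
      by (simp add: scaleR_sum_right)
    show "integrable lborel (\<lambda>x. ?I x *\<^sub>R (p x * cnj (p x)))"
      unfolding eq by (intro Bochner_Integration.integrable_sum integrable_mult_right cisI)
    have "(LBINT x. ?I x *\<^sub>R (p x * cnj (p x))) = (\<Sum>j\<in>S. LBINT x. \<Sum>k\<in>S. (a j * cnj (a k)) * (?I x *\<^sub>R cis (real_of_int (j - k) * (x/L))))"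
      unfolding eq by (intro Bochner_Integration.integral_sum Bochner_Integration.integrable_sum integrable_mult_right cisI)
    also have "\<dots> = (\<Sum>j\<in>S. \<Sum>k\<in>S. LBINT x. (a j * cnj (a k)) * (?I x *\<^sub>R cis (real_of_int (j - k) * (x/L))))"
      by (intro sum.cong refl Bochner_Integration.integral_sum integrable_mult_right cisI)
    also have "\<dots> = (\<Sum>j\<in>S. \<Sum>k\<in>S. if k = j then (a j * cnj (a j)) * of_real (2 * pi * L) else 0)"
    proof (intro sum.cong refl)
      fix j k
      have "(LBINT x. (a j * cnj (a k)) * (?I x *\<^sub>R cis (real_of_int (j - k) * (x/L)))) 
         = (a j * cnj (a k)) * (LBINT x. ?I x *\<^sub>R cis (real_of_int (j - k) * (x/L)))"
        by (rule integral_mult_right_zero)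
      then show "(LBINT x. (a j * cnj (a k)) * (?I x *\<^sub>R cis (real_of_int (j - k) * (x/L)))) 
          = (if k = j then (a j * cnj (a j)) * of_real (2 * pi * L) else 0)"
        using integral_cis[OF L, of "j - k"] by (simp add: set_lebesgue_integral_def)
    qed
    also have "\<dots> = of_real (2 * pi * L * (\<Sum>k\<in>S. (norm (a k))\<^sup>2))"
      using S by (simp add: complex_norm_square[symmetric] sum_distrib_left mult_ac)
    finally show "(LBINT x. ?I x *\<^sub>R (p x * cnj (p x))) = of_real (2 * pi * L * (\<Sum>k\<in>S. (norm (a k))\<^sup>2))" .
  qed
  have pp': "integrable lborel (\<lambda>x. ?I x * (norm (p x))\<^sup>2)"
     "(LBINT x. ?I x * (norm (p x))\<^sup>2) = 2 * pi * L * (\<Sum>k\<in>S. (norm (a k))\<^sup>2)"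
  proof -
    have eq: "?I x * (norm (p x))\<^sup>2 = Re (?I x *\<^sub>R (p x * cnj (p x)))" for x
      by (simp add: complex_norm_square[symmetric])
    show "integrable lborel (\<lambda>x. ?I x * (norm (p x))\<^sup>2)"
      unfolding eq using pp(1) by (rule integrable_Re)
    show "(LBINT x. ?I x * (norm (p x))\<^sup>2) = 2 * pi * L * (\<Sum>k\<in>S. (norm (a k))\<^sup>2)"
      unfolding eq using integral_Re[OF pp(1)] pp(2) by simp
  qed
  have "?I x * (norm (of_real (f x) - p x))\<^sup>2 = (f x)\<^sup>2 - 2 * Re (of_real (f x) * p x) + ?I x * (norm (p x))\<^sup>2" for x
    using I1[of x] by (cases "f x = 0") (auto simp: cmod_power2 power2_diff algebra_simps)
  then have "(LBINT x:{-pi*L..pi*L}. (norm (of_real (f x) - p x))\<^sup>2)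
     = (LBINT x. (f x)\<^sup>2 - 2 * Re (of_real (f x) * p x) + ?I x * (norm (p x))\<^sup>2)"
    by (simp add: set_lebesgue_integral_def)
  also have "\<dots> = (LBINT x. (f x)\<^sup>2) - 2 * Re (\<Sum>k\<in>S. a k * c k) + 2 * pi * L * (\<Sum>k\<in>S. (norm (a k))\<^sup>2)"
    using f(2) integrable_Re[OF fp(1)] integral_Re[OF fp(1)] fp(2) pp' by simp
  also have "\<dots> = (LBINT x. (f x)\<^sup>2) + (\<Sum>k\<in>S. 2 * pi * L * (norm (a k))\<^sup>2 - 2 * Re (a k * c k))"
    by (simp add: sum_subtractf sum_distrib_left)
  also have "(\<Sum>k\<in>S. 2 * pi * L * (norm (a k))\<^sup>2 - 2 * Re (a k * c k))
    = (\<Sum>k\<in>S. 2 * pi * L * (norm (a k - cnj (c k) / of_real (2 * pi * L)))\<^sup>2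
        - (norm (c k))\<^sup>2 / (2 * pi * L))"
  proof (rule sum.cong[OF refl])
    fix k
    define N where "N = 2 * pi * L"
    have N: "0 < N" using L by (simp add: N_def)
    have "N * (norm (a k))\<^sup>2 - 2 * Re (a k * c k)
      = N * (norm (a k - cnj (c k) / of_real N))\<^sup>2 - (norm (c k))\<^sup>2 / N"
      using N unfolding cmod_power2 by (simp add: field_simps power2_eq_square)
    then show "2 * pi * L * (norm (a k))\<^sup>2 - 2 * Re (a k * c k) = 2 * pi * L * (norm (a k - cnj (c k) / of_real (2 * pi * L)))\<^sup>2
        - (norm (c k))\<^sup>2 / (2 * pi * L)" unfolding N_def .
  qed
  finally show ?thesis unfolding p_def .
qed

lemma bessel:
  fixes f :: "real \<Rightarrow> real"
  assumes f: "f \<in> borel_measurable borel" "integrable lborel (\<lambda>x. (f x)\<^sup>2)"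
    and L: "0 < L" and supp: "\<And>x. L \<le> \<bar>x\<bar> \<Longrightarrow> f x = 0" and S: "finite (S :: int set)"
  shows "(\<Sum>k\<in>S. (cos_transform (real_of_int k / L) f)\<^sup>2 + (sin_transform (real_of_int k / L) f)\<^sup>2)
    \<le> 2 * pi * L * (LBINT x. (f x)\<^sup>2)"
proof -
  let ?c = "\<lambda>k. Complex (cos_transform (real_of_int k / L) f) (sin_transform (real_of_int k / L) f)"
  have "0 \<le> (LBINT x:{-pi*L..pi*L}. (norm (of_real (f x)
      - (\<Sum>k\<in>S. cnj (?c k) / of_real (2 * pi * L) * cis (real_of_int k * (x / L)))))\<^sup>2)"
    unfolding set_lebesgue_integral_def by (intro integral_nonneg_AE AE_I2) simp
  also have "\<dots> = (LBINT x. (f x)\<^sup>2) - (\<Sum>k\<in>S. (norm (?c k))\<^sup>2 / (2 * pi * L))"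
    by (subst trig_approximation_error[OF f L supp S, of "\<lambda>k. cnj (?c k) / of_real (2 * pi * L)"])
      (simp_all add: sum_negf)
  finally have "(\<Sum>k\<in>S. (norm (?c k))\<^sup>2) / (2 * pi * L) \<le> (LBINT x. (f x)\<^sup>2)"
    by (simp add: sum_divide_distrib)
  then have "(\<Sum>k\<in>S. (norm (?c k))\<^sup>2) \<le> (LBINT x. (f x)\<^sup>2) * (2 * pi * L)"
    using L by (subst (asm) pos_divide_le_eq) auto
  then show ?thesis
    by (simp add: cmod_power2 mult_ac)
qed

text \<open>
  Enlarging \<open>S\<close> only increases the sum. The bound can therefore be used for several functions at once, by
  taking the union of their sets \<open>S0\<close>.
\<close>
lemma parseval_le:
  fixes f :: "real \<Rightarrow> real"
  assumes f: "f \<in> borel_measurable borel" "integrable lborel (\<lambda>x. (f x)\<^sup>2)"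
    and L: "0 < L" and supp: "\<And>x. L \<le> \<bar>x\<bar> \<Longrightarrow> f x = 0" and e: "0 < e"
  obtains S0 where "finite S0" "\<And>S. finite S \<Longrightarrow> S0 \<subseteq> S \<Longrightarrow> (LBINT x. (f x)\<^sup>2) \<le>
     e + (\<Sum>k\<in>S. (cos_transform (real_of_int k / L) f)\<^sup>2 + (sin_transform (real_of_int k / L) f)\<^sup>2) / (2 * pi * L)"
proof -
  let ?I = "indicat_real {-pi*L..pi*L}"
  let ?c = "\<lambda>k. Complex (cos_transform (real_of_int k / L) f) (sin_transform (real_of_int k / L) f)"
  \<comment> \<open>With error \<open>d\<close> uniformly on an interval of length \<open>2 \<pi> L\<close>, the contribution \<open>2 d\<^sup>2\<close> of the
    trigonometric polynomial integrates to \<open>e / 2\<close>.\<close>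
  define d where "d = sqrt (e / (8 * pi * L))"
  have d: "0 < d" "d\<^sup>2 = e / (8 * pi * L)" using e L by (auto simp: d_def)
  obtain g M where g: "continuous_on UNIV g" "\<And>x. \<bar>g x\<bar> \<le> M" "(LBINT x:{-pi*L..pi*L}. (f x - g x)\<^sup>2) < e / 4"
    using L2_approx[OF f, of "e / 4" "- pi * L" "pi * L"] e by auto
  \<comment> \<open>A plateau equal to \<open>1\<close> on the rescaled support of \<open>f\<close> makes \<open>g\<close> periodic without losing accuracy: where
    \<open>\<psi>\<close> is below \<open>1\<close>, \<open>f\<close> vanishes and \<open>\<psi> g\<close> is closer to \<open>0\<close> than \<open>g\<close>.\<close>
  define \<psi> where "\<psi> = (\<lambda>\<theta>::real. max 0 (min 1 (3 - 2 * \<bar>\<theta>\<bar>)))"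
  have \<psi>: "continuous_on UNIV \<psi>" "0 \<le> \<psi> \<theta>" "\<psi> \<theta> \<le> 1" "\<bar>\<theta>\<bar> \<le> 1 \<Longrightarrow> \<psi> \<theta> = 1" "3/2 \<le> \<bar>\<theta>\<bar> \<Longrightarrow> \<psi> \<theta> = 0" for \<theta>
    unfolding \<psi>_def by (auto intro!: continuous_intros)
  have "continuous_on UNIV (\<lambda>\<theta>. \<psi> \<theta> * g (L * \<theta>))"
    by (intro continuous_intros \<psi> continuous_on_compose2[OF g(1)]) auto
  then obtain p where "trig_poly p"
    and p: "\<And>\<theta>. \<theta> \<in> {-pi<..pi} \<Longrightarrow> norm (complex_of_real (\<psi> \<theta> * g (L * \<theta>)) - p \<theta>) < d"
    using trig_poly_dense[of "\<lambda>\<theta>. \<psi> \<theta> * g (L * \<theta>)" d] \<psi>(5) d by auto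
  then obtain S0 a where S0: "finite (S0::int set)" and p_def: "p = (\<lambda>\<theta>. \<Sum>k\<in>S0. a k * cis (real_of_int k * \<theta>))"
    unfolding trig_poly_def by blast
  have [measurable]: "f \<in> borel_measurable borel" "g \<in> borel_measurable borel"
    using f(1) g(1) by (auto intro: borel_measurable_continuous_onI)
  have cls: "\<bar>f x - \<psi> (x / L) * g x\<bar> \<le> \<bar>f x - g x\<bar>" for x
  proof (cases "L \<le> \<bar>x\<bar>")
    case True
    then show ?thesis
      using \<psi>(2,3)[of "x / L"] supp[of x] mult_right_mono[of "\<psi> (x/L)" 1 "\<bar>g x\<bar>"] by (simp add: abs_mult)
  next
    case False
    then have "\<psi> (x / L) = 1" using L by (intro \<psi>(4)) (simp add: field_simps)
    then show ?thesis by simp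
  qed
  have icst: "integrable lborel (\<lambda>x. ?I x * r)" for r
    by (intro integrable_mult_left integrable_real_indicator) (auto simp: emeasure_lborel_Icc_eq)
  have ifg: "integrable lborel (\<lambda>x. ?I x * (f x - g x)\<^sup>2)"
  proof (rule Bochner_Integration.integrable_bound)
    show "integrable lborel (\<lambda>x. 2 * (f x)\<^sup>2 + ?I x * (2 * M\<^sup>2))"
      using f(2) icst by simp
    have "(f x - g x)\<^sup>2 \<le> 2 * (f x)\<^sup>2 + 2 * M\<^sup>2" for x
    proof -
      have "(f x - g x)\<^sup>2 \<le> 2 * (f x)\<^sup>2 + 2 * (g x)\<^sup>2"
        using sum_squares_bound[of "f x" "- g x"] by (simp add: power2_eq_square algebra_simps)
      moreover have "(g x)\<^sup>2 \<le> M\<^sup>2"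
        using g(2)[of x] by (metis abs_ge_zero power2_abs power_mono)
      ultimately show ?thesis by linarith
    qed
    then show "AE x in lborel. norm (?I x * (f x - g x)\<^sup>2) \<le> norm (2 * (f x)\<^sup>2 + ?I x * (2 * M\<^sup>2))"
      by (intro AE_I2) (auto simp: indicator_def)
  qed simp
  have "(LBINT x:{-pi*L..pi*L}. (norm (of_real (f x) - p (x / L)))\<^sup>2) \<le> (LBINT x. 2 * (?I x * (f x - g x)\<^sup>2) + ?I x * (2 * d\<^sup>2))"
    unfolding set_lebesgue_integral_def
  proof (rule integral_mono_AE')
    show "integrable lborel (\<lambda>x. 2 * (?I x * (f x - g x)\<^sup>2) + ?I x * (2 * d\<^sup>2))"
      using ifg icst[of "2 * d\<^sup>2"] by simp
    \<comment> \<open>The left end of the interval corresponds to \<open>- \<pi>\<close>, which is not a value of \<open>Arg\<close>.\<close>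
    show "AE x in lborel. ?I x *\<^sub>R (norm (of_real (f x) - p (x / L)))\<^sup>2 \<le> 2 * (?I x * (f x - g x)\<^sup>2) + ?I x * (2 * d\<^sup>2)"
      using AE_lborel_singleton[of "- pi * L"]
    proof eventually_elim
      case (elim x)
      show ?case
      proof (cases "x \<in> {-pi*L..pi*L}")
        case True
        then have "x / L \<in> {-pi<..pi}" using elim L by (auto simp: field_simps)
        then have 1: "norm (complex_of_real (\<psi> (x / L) * g x) - p (x / L)) \<le> d"
          using p[of "x / L"] L by simp
        have "norm (of_real (f x) - p (x / L)) 
          \<le> norm (complex_of_real (f x - \<psi> (x / L) * g x)) + norm (complex_of_real (\<psi> (x / L) * g x) - p (x / L))"
          by (rule order_trans[OF _ norm_triangle_ineq]) simp
        also have "\<dots> \<le> \<bar>f x - g x\<bar> + d"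
          using cls[of x] 1 unfolding norm_of_real by linarith
        finally have "(norm (of_real (f x) - p (x / L)))\<^sup>2 \<le> (\<bar>f x - g x\<bar> + d)\<^sup>2"
          by (intro power_mono) auto
        also have "\<dots> \<le> 2 * (f x - g x)\<^sup>2 + 2 * d\<^sup>2"
          using sum_squares_bound[of "\<bar>f x - g x\<bar>" d] by (simp add: power2_sum)
        finally show ?thesis using True by simp
      qed auto
    qed
  qed auto
  also have "\<dots> = 2 * (LBINT x:{-pi*L..pi*L}. (f x - g x)\<^sup>2) + 2 * pi * L * (2 * d\<^sup>2)"
    using ifg icst[of "2 * d\<^sup>2"] L
    by (simp add: set_lebesgue_integral_def measure_def emeasure_lborel_Icc_eq)
  also have "\<dots> \<le> e"
    using g(3) L d by (simp add: field_simps)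
  finally have err: "(LBINT x:{-pi*L..pi*L}. (norm (of_real (f x) - p (x / L)))\<^sup>2) \<le> e" .
  show thesis
  proof (rule that[OF S0])
    fix S assume S: "finite S" "S0 \<subseteq> S"
    have "0 \<le> (\<Sum>k\<in>S0. 2 * pi * L * (norm (a k - cnj (?c k) / of_real (2 * pi * L)))\<^sup>2)"
      using L by (intro sum_nonneg) simp
    then have "(LBINT x. (f x)\<^sup>2) \<le> e + (\<Sum>k\<in>S0. (norm (?c k))\<^sup>2 / (2 * pi * L))"
      using trig_approximation_error[OF f L supp S0, of a] err unfolding p_def sum_subtractf by linarith
    also have "\<dots> \<le> e + (\<Sum>k\<in>S. (norm (?c k))\<^sup>2 / (2 * pi * L))"
      using S L by (intro add_left_mono sum_mono2) auto
    finally show "(LBINT x. (f x)\<^sup>2) \<le>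
     e + (\<Sum>k\<in>S. (cos_transform (real_of_int k / L) f)\<^sup>2 + (sin_transform (real_of_int k / L) f)\<^sup>2) / (2 * pi * L)"
      by (simp add: cmod_power2 sum_divide_distrib)
  qed
qed

section \<open>Cutoffs and test functions\<close>

text \<open>
  The square smooths the kink of \<open>max 0 z\<close>; this is what makes the cutoff below continuously differentiable.
\<close>
lemma max_0_power2_deriv:
  "((\<lambda>z::real. (max 0 z)\<^sup>2) has_real_derivative 2 * max 0 z) (at z)"
proof -
  consider "z < 0" | "z = 0" | "0 < z" by linarith
  then show ?thesis
  proof cases
    case 1
    have "((\<lambda>z::real. 0) has_real_derivative 0) (at z)" by simp
    then have "((\<lambda>z::real. (max 0 z)\<^sup>2) has_real_derivative 0) (at z)"
      by (rule has_field_derivative_transform_within_open[where S="{..<0}"]) (use 1 in auto)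
    then show ?thesis using 1 by simp
  next
    case 3
    have "((\<lambda>z::real. z\<^sup>2) has_real_derivative 2 * z) (at z)" 
      by (auto intro!: derivative_eq_intros)
    then have "((\<lambda>z::real. (max 0 z)\<^sup>2) has_real_derivative 2 * z) (at z)"
      by (rule has_field_derivative_transform_within_open[where S="{0<..}"]) (use 3 in auto)
    then show ?thesis using 3 by simp
  next
    case 2
    have "((\<lambda>h. (max 0 h)\<^sup>2 / h) \<longlongrightarrow> 0) (at (0::real))"
    proof (rule Lim_null_comparison)
      show "eventually (\<lambda>h. norm ((max 0 h)\<^sup>2 / h) \<le> \<bar>h\<bar>) (at (0::real))"
        by (intro always_eventually allI) (auto simp: max_def power2_eq_square)
      show "((\<lambda>h::real. \<bar>h\<bar>) \<longlongrightarrow> 0) (at 0)"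
        by (intro tendsto_eq_intros) auto
    qed
    then show ?thesis using 2 by (simp add: DERIV_def)
  qed
qed

text \<open>
  Polynomial inside its support, so that the derivative is explicit. It equals \<open>1\<close> only at the origin, but it
  increases to \<open>1\<close> pointwise as \<open>n\<close> grows, which is enough to recover the untruncated norm.
\<close>
definition cutoff :: "real \<Rightarrow> real \<Rightarrow> real" where
  "cutoff n x = (max 0 (1 - (x / n)\<^sup>2))\<^sup>2"

definition cutoff' :: "real \<Rightarrow> real \<Rightarrow> real" where
  "cutoff' n x = - 4 * x / n\<^sup>2 * max 0 (1 - (x / n)\<^sup>2)"

lemma cutoff_deriv:
  assumes "0 < n"
  shows "(cutoff n has_real_derivative cutoff' n x) (at x)"
proof -
  have "((\<lambda>x. 1 - (x / n)\<^sup>2) has_real_derivative (- 2 * x / n\<^sup>2)) (at x)"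
    using assms by (auto intro!: derivative_eq_intros simp: power2_eq_square)
  then have "((\<lambda>x. (max 0 (1 - (x / n)\<^sup>2))\<^sup>2) has_real_derivative 2 * max 0 (1 - (x / n)\<^sup>2) * (- 2 * x / n\<^sup>2)) (at x)"
    by (rule DERIV_chain2[OF max_0_power2_deriv])
  then show ?thesis
    by (simp add: cutoff_def[abs_def] cutoff'_def mult_ac)
qed

lemma cutoff_eq_0:
  assumes "0 < n" "n \<le> \<bar>x\<bar>"
  shows "cutoff n x = 0" "cutoff' n x = 0"
proof -
  have "1 \<le> \<bar>x / n\<bar>" using assms by simp
  then have "1 \<le> (x / n)\<^sup>2" by (metis abs_1 abs_le_square_iff one_power2)
  then show "cutoff n x = 0" "cutoff' n x = 0" by (auto simp: cutoff_def cutoff'_def)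
qed

lemma cutoff_bounds: "0 \<le> cutoff n x" "cutoff n x \<le> 1"
  by (auto simp: cutoff_def power_le_one)

lemma abs_cutoff_le: "\<bar>cutoff n x\<bar> \<le> 1"
  using cutoff_bounds[of n x] by simp

lemma cutoff'_bound:
  assumes "0 < n"
  shows "\<bar>cutoff' n x\<bar> \<le> 4 / n"
proof (cases "n \<le> \<bar>x\<bar>")
  case False
  have "\<bar>cutoff' n x\<bar> = 4 * \<bar>x\<bar> / n\<^sup>2 * max 0 (1 - (x / n)\<^sup>2)"
    by (simp add: cutoff'_def abs_mult)
  also have "\<dots> \<le> 4 * n / n\<^sup>2 * 1"
    using False assms by (intro mult_mono divide_right_mono) auto
  finally show ?thesis using assms by (simp add: power2_eq_square)
qed (use cutoff_eq_0 assms in auto)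

lemma continuous_on_cutoff:
  assumes "0 < n"
  shows "continuous_on A (cutoff n)" "continuous_on A (cutoff' n)"
  unfolding cutoff_def[abs_def] cutoff'_def[abs_def] using assms by (auto intro!: continuous_intros)

lemma cutoff_tendsto_1: "(\<lambda>n. cutoff (real (Suc n)) x) \<longlonglongrightarrow> 1"
proof -
  have "(\<lambda>n. x / real (Suc n)) \<longlonglongrightarrow> 0"
    using tendsto_mult[OF tendsto_const[of x] LIMSEQ_inverse_real_of_nat] by (simp add: divide_inverse)
  then have "(\<lambda>n. (max 0 (1 - (x / real (Suc n))\<^sup>2))\<^sup>2) \<longlonglongrightarrow> (max 0 (1 - 0\<^sup>2))\<^sup>2"
    by (intro tendsto_intros)
  then show ?thesis by (simp add: cutoff_def)
qed

lemma test_funI: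
  fixes \<phi> \<phi>' :: "real \<Rightarrow> real"
  assumes "\<And>x. (\<phi> has_real_derivative \<phi>' x) (at x)" "continuous_on UNIV \<phi>'"
    and supp: "\<forall>x. n \<le> \<bar>x\<bar> \<longrightarrow> \<phi> x = 0"
  shows "test_fun \<phi>" "deriv \<phi> = \<phi>'"
proof -
  have "{x. \<phi> x \<noteq> 0} \<subseteq> {-n..n}"
  proof
    fix x assume "x \<in> {x. \<phi> x \<noteq> 0}"
    then have "\<bar>x\<bar> < n" using supp by force
    then show "x \<in> {-n..n}" by auto
  qed
  then have "compact (closure {x. \<phi> x \<noteq> 0})"
    using bounded_subset[OF bounded_closed_interval] by (simp add: compact_closure)
  moreover have "\<phi> C1_differentiable_on UNIV"
    unfolding C1_differentiable_on_def using assms(1,2)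
    by (auto simp: has_real_derivative_iff_has_vector_derivative)
  ultimately show "test_fun \<phi>" unfolding test_fun_def by blast
  show "deriv \<phi> = \<phi>'" using assms(1) by (auto intro: DERIV_imp_deriv)
qed

section \<open>Pairings of a solution with test functions\<close>

text \<open>
  Continuity of a solution into \<open>L\<^sup>2\<close> passes to its pairings by the Cauchy-Schwarz inequality.
\<close>
lemma solution_pairing_continuous:
  fixes \<psi> :: "real \<Rightarrow> real"
  assumes sol: "GT_solution u v u0 v0" and \<psi>: "continuous_on UNIV \<psi>" "\<forall>x. n \<le> \<bar>x\<bar> \<longrightarrow> \<psi> x = 0"
  shows "continuous_on {0..} (\<lambda>s. LBINT x. u s x * \<psi> x)"
    and "continuous_on {0..} (\<lambda>s. LBINT x. v s x * \<psi> x)"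
proof -
  have L2: "in_Lp 2 (u s)" "in_Lp 2 (v s)" if "0 \<le> s" for s
    using sol that by (auto simp: GT_solution_def)
  have \<psi>2: "in_Lp 2 \<psi>"
  proof -
    have "integrable lborel (\<lambda>x. indicat_real {-n..n} x *\<^sub>R (\<psi> x)\<^sup>2)"
      unfolding set_integrable_def[symmetric]
      by (intro borel_integrable_atLeastAtMost' continuous_intros continuous_on_subset[OF \<psi>(1)]) auto
    also have "(\<lambda>x. indicat_real {-n..n} x *\<^sub>R (\<psi> x)\<^sup>2) = (\<lambda>x. (\<psi> x)\<^sup>2)"
    proof
      fix x show "indicat_real {-n..n} x *\<^sub>R (\<psi> x)\<^sup>2 = (\<psi> x)\<^sup>2"
        using \<psi>(2) by (cases "n \<le> \<bar>x\<bar>") (auto simp: indicator_def)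
    qed
    finally show ?thesis
      using \<psi>(1) by (simp add: in_Lp_2_iff borel_measurable_continuous_onI)
  qed
  define C where "C = (LBINT x. (\<psi> x)\<^sup>2)"
  define D where "D = (\<lambda>s r. Lp_norm 2 (\<lambda>x. (u s x, v s x) - (u r x, v r x)))"
  have D: "(D s r)\<^sup>2 = (LBINT x. (u s x - u r x)\<^sup>2 + (v s x - v r x)\<^sup>2)" for s r
    unfolding D_def diff_Pair Lp_norm_2_pair ..
  have Dnn: "0 \<le> D s r" for s r
    by (simp add: D_def Lp_norm_def)
  have C: "0 \<le> C" unfolding C_def by (intro integral_nonneg_AE AE_I2) simp
  have key: "continuous_on {0..} (\<lambda>s. LBINT x. w s x * \<psi> x)"
    if w2: "\<And>s. 0 \<le> s \<Longrightarrow> in_Lp 2 (w s)"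
      and wD: "\<And>s r. 0 \<le> s \<Longrightarrow> 0 \<le> r \<Longrightarrow> (LBINT x. (w s x - w r x)\<^sup>2) \<le> (D s r)\<^sup>2" for w
  proof (unfold continuous_on_def, intro ballI)
    fix r :: real assume r: "r \<in> {0..}"
    have "((\<lambda>s. (LBINT x. w s x * \<psi> x) - (LBINT x. w r x * \<psi> x)) \<longlongrightarrow> 0) (at r within {0..})"
    proof (rule Lim_null_comparison)
      show "eventually (\<lambda>s. norm ((LBINT x. w s x * \<psi> x) - (LBINT x. w r x * \<psi> x)) \<le> D s r * sqrt C) (at r within {0..})"
        unfolding eventually_at_filter
      proof (intro always_eventually allI impI)
        fix s :: real assume s: "s \<in> {0..}"
        have "(LBINT x. w s x * \<psi> x) - (LBINT x. w r x * \<psi> x) = (LBINT x. (w s x - w r x) * \<psi> x)"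
          using integrable_L2_mult[OF w2 \<psi>2] r s by (simp add: left_diff_distrib)
        then have "((LBINT x. w s x * \<psi> x) - (LBINT x. w r x * \<psi> x))\<^sup>2 \<le> (LBINT x. (w s x - w r x)\<^sup>2) * C"
          using L2_Cauchy_Schwarz[OF in_Lp_2_diff[OF w2 w2] \<psi>2, of s r] r s by (simp add: C_def)
        also have "\<dots> \<le> (D s r)\<^sup>2 * C"
          using wD[of s r] r s C by (intro mult_right_mono) auto
        also have "\<dots> = (D s r * sqrt C)\<^sup>2"
          using C by (simp add: power_mult_distrib)
        finally show "norm ((LBINT x. w s x * \<psi> x) - (LBINT x. w r x * \<psi> x)) \<le> D s r * sqrt C"
          using Dnn C by (auto intro!: power2_le_imp_le[of "\<bar>_\<bar>"])
      qed
      have "((\<lambda>s. D s r) \<longlongrightarrow> 0) (at r within {0..})"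
        using sol r unfolding GT_solution_def D_def by simp
      then show "((\<lambda>s. D s r * sqrt C) \<longlongrightarrow> 0) (at r within {0..})"
        by (rule tendsto_mult_left_zero)
    qed
    then show "((\<lambda>s. LBINT x. w s x * \<psi> x) \<longlongrightarrow> (LBINT x. w r x * \<psi> x)) (at r within {0..})"
      using LIM_zero_iff by blast
  qed
  have dom: "(LBINT x. (u s x - u r x)\<^sup>2) \<le> (D s r)\<^sup>2" "(LBINT x. (v s x - v r x)\<^sup>2) \<le> (D s r)\<^sup>2"
    if "0 \<le> s" "0 \<le> r" for s r
  proof -
    have int: "integrable lborel (\<lambda>x. (u s x - u r x)\<^sup>2)" "integrable lborel (\<lambda>x. (v s x - v r x)\<^sup>2)"
      using in_Lp_2_diff[OF L2(1) L2(1)] in_Lp_2_diff[OF L2(2) L2(2)] that by (auto simp: in_Lp_2_iff)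
    show "(LBINT x. (u s x - u r x)\<^sup>2) \<le> (D s r)\<^sup>2" "(LBINT x. (v s x - v r x)\<^sup>2) \<le> (D s r)\<^sup>2"
      unfolding D using int by (auto intro!: integral_mono)
  qed
  show "continuous_on {0..} (\<lambda>s. LBINT x. u s x * \<psi> x)" "continuous_on {0..} (\<lambda>s. LBINT x. v s x * \<psi> x)"
    by (intro key L2 dom; simp)+
qed

text \<open>
  Continuity in time with values in \<open>L\<^sup>2\<close> makes the energy locally bounded, and \<open>[0, t]\<close> is compact. The bound
  controls the source that the cutoff creates.
\<close>
lemma solution_energy_bounded:
  assumes sol: "GT_solution u v u0 v0"
  obtains M where "\<And>s. s \<in> {0..t} \<Longrightarrow> (LBINT x. (u s x)\<^sup>2 + (v s x)\<^sup>2) \<le> M"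
proof -
  have L2: "in_Lp 2 (u s)" "in_Lp 2 (v s)" if "0 \<le> s" for s
    using sol that by (auto simp: GT_solution_def)
  define E where "E = (\<lambda>s. LBINT x. (u s x)\<^sup>2 + (v s x)\<^sup>2)"
  define D where "D = (\<lambda>s r. Lp_norm 2 (\<lambda>x. (u s x, v s x) - (u r x, v r x)))"
  have D: "(D s r)\<^sup>2 = (LBINT x. (u s x - u r x)\<^sup>2 + (v s x - v r x)\<^sup>2)" for s r
    unfolding D_def diff_Pair Lp_norm_2_pair ..
  have Dnn: "0 \<le> D s r" for s r
    by (simp add: D_def Lp_norm_def)
  have E: "E s \<le> 2 * E r + 2 * (D s r)\<^sup>2" if "0 \<le> s" "0 \<le> r" for s r
  proof -
    have int: "integrable lborel (\<lambda>x. (u s x)\<^sup>2 + (v s x)\<^sup>2)" "integrable lborel (\<lambda>x. (u r x)\<^sup>2 + (v r x)\<^sup>2)" 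
        "integrable lborel (\<lambda>x. (u s x - u r x)\<^sup>2 + (v s x - v r x)\<^sup>2)"
      using L2 in_Lp_2_diff[OF L2(1) L2(1)] in_Lp_2_diff[OF L2(2) L2(2)] that by (auto simp: in_Lp_2_iff)
    have "p\<^sup>2 \<le> 2 * q\<^sup>2 + 2 * (p - q)\<^sup>2" for p q :: real
      using zero_le_power2[of "p - 2 * q"] by (simp add: power2_eq_square algebra_simps)
    note le = this
    have "E s \<le> (LBINT x. 2 * ((u r x)\<^sup>2 + (v r x)\<^sup>2) + 2 * ((u s x - u r x)\<^sup>2 + (v s x - v r x)\<^sup>2))"
      unfolding E_def
    proof (rule integral_mono[OF int(1)])
      show "integrable lborel (\<lambda>x. 2 * ((u r x)\<^sup>2 + (v r x)\<^sup>2) + 2 * ((u s x - u r x)\<^sup>2 + (v s x - v r x)\<^sup>2))"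
        by (intro Bochner_Integration.integrable_add integrable_mult_right int)
      show "(u s x)\<^sup>2 + (v s x)\<^sup>2 \<le> 2 * ((u r x)\<^sup>2 + (v r x)\<^sup>2) + 2 * ((u s x - u r x)\<^sup>2 + (v s x - v r x)\<^sup>2)" for x
        using add_mono[OF le[of "u s x" "u r x"] le[of "v s x" "v r x"]]
        by (simp only: distrib_left add_ac)
    qed
    also have "\<dots> = 2 * E r + 2 * (D s r)\<^sup>2"
      unfolding E_def D
      by (subst Bochner_Integration.integral_add; (intro integrable_mult_right int)?)
        (simp only: integral_mult_right_zero)
    finally show ?thesis .
  qed
  \<comment> \<open>Otherwise the energy would be unbounded along a convergent sequence of times.\<close>
  have "\<exists>M. \<forall>s\<in>{0..t}. E s \<le> M"
  proof (rule ccontr)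
    assume "\<not> ?thesis"
    then have "\<forall>k. \<exists>s\<in>{0..t}. real k < E s" by (meson not_le)
    then obtain \<sigma> where \<sigma>: "\<And>k. \<sigma> k \<in> {0..t}" "\<And>k. real k < E (\<sigma> k)" by metis
    have "seq_compact {0..t}" by (simp add: compact_imp_seq_compact)
    then obtain l \<tau> where l: "l \<in> {0..t}" "strict_mono \<tau>" "(\<sigma> \<circ> \<tau>) \<longlonglongrightarrow> l"
      using \<sigma>(1) by (meson seq_compactE)
    have "((\<lambda>s. D s l) \<longlongrightarrow> 0) (at l within {0..})"
      using sol l unfolding GT_solution_def D_def by simp
    moreover have "D l l = 0" by (simp add: D_def Lp_norm_def)
    ultimately have "continuous (at l within {0..}) (\<lambda>s. D s l)"
      by (simp add: continuous_within)
    then have "(\<lambda>k. D ((\<sigma> \<circ> \<tau>) k) l) \<longlonglongrightarrow> D l l"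
      by (rule continuous_within_tendsto_compose) (use \<sigma>(1) l in \<open>auto simp: comp_def\<close>)
    then have "eventually (\<lambda>k. D ((\<sigma> \<circ> \<tau>) k) l < 1) sequentially"
      using \<open>D l l = 0\<close> by (intro order_tendstoD(2)) auto
    moreover have "eventually (\<lambda>k. 2 * E l + 2 \<le> real k) sequentially"
      using eventually_ge_at_top[of "nat \<lceil>2 * E l + 2\<rceil>"] by eventually_elim linarith
    ultimately have "eventually (\<lambda>k. False) sequentially"
    proof eventually_elim
      case (elim k)
      have "(D (\<sigma> (\<tau> k)) l)\<^sup>2 \<le> 1"
        using elim Dnn by (simp add: power_le_one)
      then have "E (\<sigma> (\<tau> k)) \<le> 2 * E l + 2"
        using E[of "\<sigma> (\<tau> k)" l] \<sigma>(1)[of "\<tau> k"] l(1) by auto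
      moreover have "real k \<le> real (\<tau> k)"
        using seq_suble[OF l(2), of k] by simp
      ultimately show False using elim \<sigma>(2)[of "\<tau> k"] by linarith
    qed
    then show False by simp
  qed
  then obtain M where "\<forall>s\<in>{0..t}. E s \<le> M" by blast
  then show thesis
    using that[of M] unfolding E_def by blast
qed

text \<open>
  The integrands in the weak formulation are continuous in time, so the fundamental theorem of calculus turns it
  into differential equations for the pairings.
\<close>
lemma solution_pairing_deriv:
  fixes \<phi> \<phi>' :: "real \<Rightarrow> real"
  assumes sol: "GT_solution u v u0 v0"
    and \<phi>: "\<And>x. (\<phi> has_real_derivative \<phi>' x) (at x)" "continuous_on UNIV \<phi>'"
    and supp: "\<forall>x. n \<le> \<bar>x\<bar> \<longrightarrow> \<phi> x = 0" "\<forall>x. n \<le> \<bar>x\<bar> \<longrightarrow> \<phi>' x = 0"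
    and s: "s \<in> {0..t}"
  shows "((\<lambda>s. LBINT x. u s x * \<phi> x) has_real_derivative (LBINT x. v s x * \<phi>' x)) (at s within {0..t})"
    and "((\<lambda>s. LBINT x. v s x * \<phi> x) has_real_derivative (LBINT x. u s x * \<phi>' x) - (LBINT x. v s x * \<phi> x)) (at s within {0..t})"
proof -
  note test = test_funI[OF \<phi> supp(1)]
  have c\<phi>: "continuous_on UNIV \<phi>"
    using \<phi>(1) by (meson DERIV_isCont continuous_at_imp_continuous_on)
  note cont = solution_pairing_continuous[OF sol c\<phi> supp(1)] solution_pairing_continuous[OF sol \<phi>(2) supp(2)]
  have key: "(f has_real_derivative g s) (at s within {0..t})"
    if g: "continuous_on {0..} g" and f: "\<And>r. 0 \<le> r \<Longrightarrow> f r = c + (LBINT s:{0..r}. g s)" for f g c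
  proof -
    have g': "continuous_on {0..t} g" using g by (rule continuous_on_subset) auto
    have "((\<lambda>r. c + integral {0..r} g) has_real_derivative g s) (at s within {0..t})"
      using integral_has_real_derivative[OF g' s] by (auto intro!: derivative_eq_intros)
    then show ?thesis
    proof (rule has_field_derivative_transform_within[where d=1])
      fix r assume r: "r \<in> {0..t}"
      have "set_integrable lborel {0..r} g"
        by (intro borel_integrable_atLeastAtMost' continuous_on_subset[OF g]) auto
      then show "c + integral {0..r} g = f r"
        using f[of r] r by (simp add: set_borel_integral_eq_integral)
    qed (use s in auto)
  qed
  have weak: "(LBINT x. u r x * \<phi> x) - (LBINT x. u0 x * \<phi> x) = (LBINT s:{0..r}. (LBINT x. v s x * \<phi>' x))"
    "(LBINT x. v r x * \<phi> x) - (LBINT x. v0 x * \<phi> x)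
      = (LBINT s:{0..r}. ((LBINT x. u s x * \<phi>' x) - (LBINT x. v s x * \<phi> x)))" if "0 \<le> r" for r
  proof -
    have "\<forall>\<phi>. test_fun \<phi> \<longrightarrow> (\<forall>t\<ge>0.
        (LBINT x. u t x * \<phi> x) - (LBINT x. u0 x * \<phi> x)
          = (LBINT s:{0..t}. (LBINT x. v s x * deriv \<phi> x)) \<and>
        (LBINT x. v t x * \<phi> x) - (LBINT x. v0 x * \<phi> x)
          = (LBINT s:{0..t}. ((LBINT x. u s x * deriv \<phi> x) - (LBINT x. v s x * \<phi> x))))"
      using sol unfolding GT_solution_def by (elim conjE)
    note w = this[rule_format, OF test(1) that, unfolded test(2)]
    show "(LBINT x. u r x * \<phi> x) - (LBINT x. u0 x * \<phi> x) = (LBINT s:{0..r}. (LBINT x. v s x * \<phi>' x))"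
      "(LBINT x. v r x * \<phi> x) - (LBINT x. v0 x * \<phi> x)
        = (LBINT s:{0..r}. ((LBINT x. u s x * \<phi>' x) - (LBINT x. v s x * \<phi> x)))"
      by (rule w[THEN conjunct1], rule w[THEN conjunct2])
  qed
  show "((\<lambda>s. LBINT x. u s x * \<phi> x) has_real_derivative (LBINT x. v s x * \<phi>' x)) (at s within {0..t})"
  proof (rule key[where c="LBINT x. u0 x * \<phi> x"])
    show "(LBINT x. u r x * \<phi> x) = (LBINT x. u0 x * \<phi> x) + (LBINT s:{0..r}. (LBINT x. v s x * \<phi>' x))" if "0 \<le> r" for r
      using weak(1)[OF that] by (simp only: diff_eq_eq add.commute)
  qed (rule cont)
  show "((\<lambda>s. LBINT x. v s x * \<phi> x) has_real_derivative (LBINT x. u s x * \<phi>' x) - (LBINT x. v s x * \<phi> x)) (at s within {0..t})"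
  proof (rule key[where c="LBINT x. v0 x * \<phi> x"])
    show "(LBINT x. v r x * \<phi> x) = (LBINT x. v0 x * \<phi> x) + (LBINT s:{0..r}. ((LBINT x. u s x * \<phi>' x) - (LBINT x. v s x * \<phi> x)))" if "0 \<le> r" for r
      using weak(2)[OF that] by (simp only: diff_eq_eq add.commute)
  qed (intro continuous_intros cont)
qed

section \<open>Modes of a truncated solution\<close>

text \<open>
  The squared Euclidean norm of the Fourier transform of \<open>(f, g)\<close> at \<open>\<xi>\<close>.
\<close>
definition mode_energy :: "real \<Rightarrow> (real \<Rightarrow> real) \<Rightarrow> (real \<Rightarrow> real) \<Rightarrow> real" where
  "mode_energy \<xi> f g = (cos_transform \<xi> f)\<^sup>2 + (sin_transform \<xi> f)\<^sup>2
     + ((cos_transform \<xi> g)\<^sup>2 + (sin_transform \<xi> g)\<^sup>2)"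

text \<open>
  Differentiating \<open>cutoff n x * cos (\<xi> x)\<close> and \<open>cutoff n x * sin (\<xi> x)\<close> in space exchanges the two up to the
  factor \<open>\<plusminus> \<xi>\<close> and leaves terms with \<open>cutoff'\<close>, which act as sources. The four real modes form two independent
  oscillators: the cosine mode of \<open>u\<close> with the sine mode of \<open>v\<close> at frequency \<open>\<xi>\<close>, and the sine mode of \<open>u\<close> with
  the cosine mode of \<open>v\<close> at frequency \<open>- \<xi>\<close>.
\<close>
lemma solution_mode_decay:
  fixes \<xi> :: real
  assumes sol: "GT_solution u v u0 v0" and t: "0 \<le> t" and n: "0 < n" and R: "0 < R" "R < 1/2" and \<eta>: "0 < \<eta>"
  defines "Y \<equiv> \<lambda>s. mode_energy \<xi> (\<lambda>x. cutoff n x * u s x) (\<lambda>x. cutoff n x * v s x)"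
    and "G \<equiv> \<lambda>s. mode_energy \<xi> (\<lambda>x. cutoff' n x * u s x) (\<lambda>x. cutoff' n x * v s x)"
  shows "continuous_on {0..t} G"
    and "(1 - 2 * R) * Y t \<le> exp (\<eta> * t) * (1 + 2 * R) *
      (exp (- 2 * mu (min \<bar>\<xi>\<bar> R) * t) * Y 0 + 1 / \<eta> * integral {0..t} G)"
proof -
  define c s c' s' where csdef: "c = (\<lambda>x. cutoff n x * cos (\<xi> * x))" "s = (\<lambda>x. cutoff n x * sin (\<xi> * x))"
    "c' = (\<lambda>x. cutoff' n x * cos (\<xi> * x))" "s' = (\<lambda>x. cutoff' n x * sin (\<xi> * x))"
  have L2: "in_Lp 2 (u s)" "in_Lp 2 (v s)" if "0 \<le> s" for s
    using sol that by (auto simp: GT_solution_def)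
  have contcs: "continuous_on UNIV c" "continuous_on UNIV s" "continuous_on UNIV c'" "continuous_on UNIV s'"
    unfolding csdef by (intro continuous_intros continuous_on_cutoff n)+
  have supp: "\<forall>x. n \<le> \<bar>x\<bar> \<longrightarrow> c x = 0" "\<forall>x. n \<le> \<bar>x\<bar> \<longrightarrow> s x = 0"
    "\<forall>x. n \<le> \<bar>x\<bar> \<longrightarrow> c' x = 0" "\<forall>x. n \<le> \<bar>x\<bar> \<longrightarrow> s' x = 0"
    using cutoff_eq_0[OF n] by (simp_all add: csdef)
  have bnd: "\<bar>c x\<bar> \<le> 1" "\<bar>s x\<bar> \<le> 1" "\<bar>c' x\<bar> \<le> 4 / n" "\<bar>s' x\<bar> \<le> 4 / n" for x
    unfolding csdef abs_mult using abs_cutoff_le[of n x] cutoff'_bound[OF n, of x] n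
    by (auto intro!: mult_le_one order_trans[OF mult_mono[of "\<bar>cutoff' n x\<bar>" "4 / n" _ 1]])
  have dc: "(c has_real_derivative (c' x - \<xi> * s x)) (at x)" for x
    unfolding csdef by (auto intro!: derivative_eq_intros cutoff_deriv n)
  have ds: "(s has_real_derivative (s' x + \<xi> * c x)) (at x)" for x
    unfolding csdef by (auto intro!: derivative_eq_intros cutoff_deriv n)
  have int: "integrable lborel (\<lambda>x. w x * \<psi> x)" if "in_Lp 2 w" "continuous_on UNIV \<psi>" "\<forall>x. n \<le> \<bar>x\<bar> \<longrightarrow> \<psi> x = 0" "\<And>x. \<bar>\<psi> x\<bar> \<le> C" for w \<psi> :: "real \<Rightarrow> real" and C
  proof (rule integrable_of_bounded_support[where L = n])
    have "in_Lp 2 (\<lambda>x. \<psi> x * w x)" by (rule in_Lp_2_mult_bounded[OF that(1,2,4)])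
    then show "(\<lambda>x. w x * \<psi> x) \<in> borel_measurable borel" "integrable lborel (\<lambda>x. (w x * \<psi> x)\<^sup>2)"
      by (simp_all add: in_Lp_2_iff mult.commute)
  qed (use that(3) in simp)
  note ints = int[OF _ contcs(1) supp(1) bnd(1)] int[OF _ contcs(2) supp(2) bnd(2)]
    int[OF _ contcs(3) supp(3) bnd(3)] int[OF _ contcs(4) supp(4) bnd(4)]
  have splitc: "(LBINT x. w x * (c' x - \<xi> * s x)) = (LBINT x. w x * c' x) - \<xi> * (LBINT x. w x * s x)"
    and splits: "(LBINT x. w x * (s' x + \<xi> * c x)) = (LBINT x. w x * s' x) + \<xi> * (LBINT x. w x * c x)"
    if w: "in_Lp 2 w" for w
  proof -
    have "(LBINT x. w x * (c' x - \<xi> * s x)) = (LBINT x. w x * c' x - \<xi> * (w x * s x))"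
      by (intro Bochner_Integration.integral_cong) (auto simp: algebra_simps)
    then show "(LBINT x. w x * (c' x - \<xi> * s x)) = (LBINT x. w x * c' x) - \<xi> * (LBINT x. w x * s x)"
      using ints[OF w] by simp
    have "(LBINT x. w x * (s' x + \<xi> * c x)) = (LBINT x. w x * s' x + \<xi> * (w x * c x))"
      by (intro Bochner_Integration.integral_cong) (auto simp: algebra_simps)
    then show "(LBINT x. w x * (s' x + \<xi> * c x)) = (LBINT x. w x * s' x) + \<xi> * (LBINT x. w x * c x)"
      using ints[OF w] by simp
  qed
  have contd: "continuous_on UNIV (\<lambda>x. c' x - \<xi> * s x)" "continuous_on UNIV (\<lambda>x. s' x + \<xi> * c x)"
    by (intro continuous_intros contcs)+
  have suppd: "\<forall>x. n \<le> \<bar>x\<bar> \<longrightarrow> c' x - \<xi> * s x = 0" "\<forall>x. n \<le> \<bar>x\<bar> \<longrightarrow> s' x + \<xi> * c x = 0"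
    using supp by simp_all
  have transf: "cos_transform \<xi> (\<lambda>x. cutoff n x * w x) = (LBINT x. w x * c x)"
     "sin_transform \<xi> (\<lambda>x. cutoff n x * w x) = (LBINT x. w x * s x)"
     "cos_transform \<xi> (\<lambda>x. cutoff' n x * w x) = (LBINT x. w x * c' x)"
     "sin_transform \<xi> (\<lambda>x. cutoff' n x * w x) = (LBINT x. w x * s' x)" for w
    by (simp_all add: cos_transform_def sin_transform_def csdef mult_ac)
  have cont0: "continuous_on {0..t} (\<lambda>r. LBINT x. u r x * c' x)" "continuous_on {0..t} (\<lambda>r. LBINT x. u r x * s' x)"
     "continuous_on {0..t} (\<lambda>r. LBINT x. v r x * c' x)" "continuous_on {0..t} (\<lambda>r. LBINT x. v r x * s' x)"
    using solution_pairing_continuous[OF sol contcs(3) supp(3)] solution_pairing_continuous[OF sol contcs(4) supp(4)]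
    by (auto elim!: continuous_on_subset)
  show contG: "continuous_on {0..t} G"
    unfolding G_def mode_energy_def transf by (intro continuous_intros cont0)
  have 1: "(1 - 2 * R) * ((LBINT x. u t x * c x)\<^sup>2 + (LBINT x. v t x * s x)\<^sup>2) \<le> exp (\<eta> * t) * (1 + 2 * R) *
    (exp (- 2 * mu (min \<bar>\<xi>\<bar> R) * t) * ((LBINT x. u 0 x * c x)\<^sup>2 + (LBINT x. v 0 x * s x)\<^sup>2)
      + 1 / \<eta> * integral {0..t} (\<lambda>r. (LBINT x. v r x * c' x)\<^sup>2 + (LBINT x. u r x * s' x)\<^sup>2))"
  proof (rule mode_decay[OF t R \<eta>])
    fix r assume r: "r \<in> {0..t}"
    show "((\<lambda>r. LBINT x. u r x * c x) has_real_derivative - \<xi> * (LBINT x. v r x * s x) + (LBINT x. v r x * c' x)) (at r within {0..t})"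
      by (rule DERIV_cong[OF solution_pairing_deriv(1)[OF sol dc contd(1) supp(1) suppd(1) r]]) (use r in \<open>simp add: splitc[OF L2(2)]\<close>)
    show "((\<lambda>r. LBINT x. v r x * s x) has_real_derivative \<xi> * (LBINT x. u r x * c x) - (LBINT x. v r x * s x) + (LBINT x. u r x * s' x)) (at r within {0..t})"
      by (rule DERIV_cong[OF solution_pairing_deriv(2)[OF sol ds contd(2) supp(2) suppd(2) r]]) (use r in \<open>simp add: splits[OF L2(1)]\<close>)
  qed (rule cont0)+
  have 2: "(1 - 2 * R) * ((LBINT x. u t x * s x)\<^sup>2 + (LBINT x. v t x * c x)\<^sup>2) \<le> exp (\<eta> * t) * (1 + 2 * R) *
    (exp (- 2 * mu (min \<bar>- \<xi>\<bar> R) * t) * ((LBINT x. u 0 x * s x)\<^sup>2 + (LBINT x. v 0 x * c x)\<^sup>2)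
      + 1 / \<eta> * integral {0..t} (\<lambda>r. (LBINT x. v r x * s' x)\<^sup>2 + (LBINT x. u r x * c' x)\<^sup>2))"
  proof (rule mode_decay[OF t R \<eta>])
    fix r assume r: "r \<in> {0..t}"
    show "((\<lambda>r. LBINT x. u r x * s x) has_real_derivative - (- \<xi>) * (LBINT x. v r x * c x) + (LBINT x. v r x * s' x)) (at r within {0..t})"
      by (rule DERIV_cong[OF solution_pairing_deriv(1)[OF sol ds contd(2) supp(2) suppd(2) r]]) (use r in \<open>simp add: splits[OF L2(2)]\<close>)
    show "((\<lambda>r. LBINT x. v r x * c x) has_real_derivative (- \<xi>) * (LBINT x. u r x * s x) - (LBINT x. v r x * c x) + (LBINT x. u r x * c' x)) (at r within {0..t})"
      by (rule DERIV_cong[OF solution_pairing_deriv(2)[OF sol dc contd(1) supp(1) suppd(1) r]]) (use r in \<open>simp add: splitc[OF L2(1)]\<close>)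
  qed (rule cont0)+
  let ?g1 = "\<lambda>r. (LBINT x. v r x * c' x)\<^sup>2 + (LBINT x. u r x * s' x)\<^sup>2"
  let ?g2 = "\<lambda>r. (LBINT x. v r x * s' x)\<^sup>2 + (LBINT x. u r x * c' x)\<^sup>2"
  have "integral {0..t} G = integral {0..t} (\<lambda>r. ?g1 r + ?g2 r)"
    by (rule Henstock_Kurzweil_Integration.integral_cong) (simp add: G_def mode_energy_def transf)
  also have "\<dots> = integral {0..t} ?g1 + integral {0..t} ?g2"
    by (intro Henstock_Kurzweil_Integration.integral_add integrable_continuous_real continuous_intros cont0)
  finally have "integral {0..t} G = integral {0..t} ?g1 + integral {0..t} ?g2" .
  moreover have "Y r = ((LBINT x. u r x * c x)\<^sup>2 + (LBINT x. v r x * s x)\<^sup>2)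
     + ((LBINT x. u r x * s x)\<^sup>2 + (LBINT x. v r x * c x)\<^sup>2)" for r
    by (simp add: Y_def mode_energy_def transf)
  ultimately show "(1 - 2 * R) * Y t \<le> exp (\<eta> * t) * (1 + 2 * R) *
      (exp (- 2 * mu (min \<bar>\<xi>\<bar> R) * t) * Y 0 + 1 / \<eta> * integral {0..t} G)"
    using add_mono[OF 1 2] unfolding abs_minus_cancel distrib_left[symmetric]
    by (simp only: distrib_left add_ac)
qed

text \<open>
  The energy is the squared norm of the integral of \<open>(f, g)\<close> times a scalar factor of modulus at most \<open>1\<close>.
  Integrating the vector as a whole, not its components one by one, keeps the constant at \<open>1\<close>.
\<close>
lemma mode_energy_le_L1:
  fixes f g \<omega> :: "real \<Rightarrow> real"
  assumes f: "in_Lp 1 f" and g: "in_Lp 1 g" and \<omega>: "continuous_on UNIV \<omega>" "\<And>x. \<bar>\<omega> x\<bar> \<le> 1"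
  shows "mode_energy \<xi> (\<lambda>x. \<omega> x * f x) (\<lambda>x. \<omega> x * g x) \<le> (Lp_norm 1 (\<lambda>x. (f x, g x)))\<^sup>2"
proof -
  define e where "e = (\<lambda>x. of_real (\<omega> x) * cis (\<xi> * x))"
  have [measurable]: "e \<in> borel_measurable borel" "f \<in> borel_measurable borel" "g \<in> borel_measurable borel"
    unfolding e_def using f g
    by (auto simp: in_Lp_def intro!: borel_measurable_continuous_onI continuous_intros continuous_on_of_real \<omega>)
  have int: "integrable lborel f" "integrable lborel g"
    using f g integrable_norm_iff[of f lborel] integrable_norm_iff[of g lborel] by (auto simp: in_Lp_def)
  have ne: "norm (e x) \<le> 1" for x using \<omega>(2)[of x] by (simp add: e_def norm_mult)
  have ice: "integrable lborel (\<lambda>x. of_real (h x) * e x)" if "integrable lborel h" for h :: "real \<Rightarrow> real"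
  proof (rule Bochner_Integration.integrable_bound[OF that])
    show "AE x in lborel. norm (of_real (h x) * e x) \<le> norm (h x)"
      using ne by (intro AE_I2) (simp add: norm_mult mult_left_le)
  qed (use that in measurable)
  have Ie: "(LBINT x. of_real (h x) * e x) = Complex (cos_transform \<xi> (\<lambda>x. \<omega> x * h x)) (sin_transform \<xi> (\<lambda>x. \<omega> x * h x))"
    if "integrable lborel h" for h :: "real \<Rightarrow> real"
    using integral_Re[OF ice[OF that]] integral_Im[OF ice[OF that]]
    by (simp add: complex_eq_iff cos_transform_def sin_transform_def e_def mult_ac)
  \<comment> \<open>Values in \<open>complex \<times> complex\<close> carry the Euclidean norm, so the norm inequality for integrals is sharp enough.\<close>
  define P where "P = (\<lambda>x. (of_real (f x) * e x, of_real (g x) * e x))"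
  have P_eq: "P x = (of_real (f x) * e x, 0) + (0, of_real (g x) * e x)" for x by (simp add: P_def)
  have P: "integrable lborel P"
    unfolding P_eq[abs_def]
    by (intro Bochner_Integration.integrable_add integrable_bounded_linear[OF _ ice] int bounded_linear_Pair bounded_linear_ident bounded_linear_zero)
  have "mode_energy \<xi> (\<lambda>x. \<omega> x * f x) (\<lambda>x. \<omega> x * g x) = (norm (LBINT x. P x))\<^sup>2"
  proof -
    have "fst (LBINT x. P x) = (LBINT x. of_real (f x) * e x)"
      using integral_bounded_linear[OF bounded_linear_fst P] by (simp add: P_def)
    moreover have "snd (LBINT x. P x) = (LBINT x. of_real (g x) * e x)"
      using integral_bounded_linear[OF bounded_linear_snd P] by (simp add: P_def)
    ultimately show ?thesis
      unfolding mode_energy_def norm_prod_def Ie[OF int(1)] Ie[OF int(2)] by (simp add: cmod_power2)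
  qed
  also have "\<dots> \<le> (LBINT x. norm (f x, g x))\<^sup>2"
  proof (rule power_mono)
    have le: "norm (P x) \<le> norm (f x, g x)" for x
    proof -
      have "norm (P x) = norm (f x, g x) * norm (e x)"
        by (simp add: P_def norm_Pair norm_mult power_mult_distrib real_sqrt_mult flip: distrib_right)
      then show ?thesis using ne[of x] by (simp add: mult_left_le)
    qed
    have "integrable lborel (\<lambda>x. norm (f x, g x))"
    proof (rule Bochner_Integration.integrable_bound)
      show "integrable lborel (\<lambda>x. \<bar>f x\<bar> + \<bar>g x\<bar>)" using int by simp
      show "AE x in lborel. norm (norm (f x, g x)) \<le> norm (\<bar>f x\<bar> + \<bar>g x\<bar>)"
        by (intro AE_I2) (simp add: norm_Pair sqrt_sum_squares_le_sum_abs)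
    qed (simp add: norm_Pair)
    then have "(LBINT x. norm (P x)) \<le> (LBINT x. norm (f x, g x))"
      using P le by (intro integral_mono) auto
    then show "norm (LBINT x. P x) \<le> (LBINT x. norm (f x, g x))"
      by (rule order_trans[OF integral_norm_bound])
  qed simp
  also have "(LBINT x. norm (f x, g x)) = Lp_norm 1 (\<lambda>x. (f x, g x))"
  proof -
    have "0 \<le> (LBINT x. norm (f x, g x))" by (intro integral_nonneg_AE AE_I2) simp
    then show ?thesis by (simp add: Lp_norm_def)
  qed
  finally show ?thesis .
qed

lemma mode_energy_bessel:
  assumes f: "in_Lp 2 f" and g: "in_Lp 2 g" and \<omega>: "continuous_on UNIV \<omega>" "\<And>x. \<bar>\<omega> x\<bar> \<le> C"
    and n: "0 < n" and supp: "\<And>x. n \<le> \<bar>x\<bar> \<Longrightarrow> \<omega> x = 0" and S: "finite S"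
  shows "(\<Sum>k\<in>S. mode_energy (real_of_int k / n) (\<lambda>x. \<omega> x * f x) (\<lambda>x. \<omega> x * g x))
    \<le> 2 * pi * n * (C\<^sup>2 * (LBINT x. (f x)\<^sup>2 + (g x)\<^sup>2))"
proof -
  have le: "(\<Sum>k\<in>S. (cos_transform (real_of_int k / n) (\<lambda>x. \<omega> x * w x))\<^sup>2 + (sin_transform (real_of_int k / n) (\<lambda>x. \<omega> x * w x))\<^sup>2)
     \<le> 2 * pi * n * (C\<^sup>2 * (LBINT x. (w x)\<^sup>2))" if w: "in_Lp 2 w" for w
  proof -
    note b = in_Lp_2_mult_bounded[OF w \<omega>]
    have "(\<Sum>k\<in>S. (cos_transform (real_of_int k / n) (\<lambda>x. \<omega> x * w x))\<^sup>2 + (sin_transform (real_of_int k / n) (\<lambda>x. \<omega> x * w x))\<^sup>2)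
      \<le> 2 * pi * n * (LBINT x. (\<omega> x * w x)\<^sup>2)"
      by (rule bessel) (use b(1) n supp S in \<open>auto simp: in_Lp_2_iff\<close>)
    also have "\<dots> \<le> 2 * pi * n * (C\<^sup>2 * (LBINT x. (w x)\<^sup>2))"
      using b(2) n by (intro mult_left_mono) auto
    finally show ?thesis .
  qed
  have "(LBINT x. (f x)\<^sup>2 + (g x)\<^sup>2) = (LBINT x. (f x)\<^sup>2) + (LBINT x. (g x)\<^sup>2)"
    using f g by (simp add: in_Lp_2_iff)
  then show ?thesis
    using add_mono[OF le[OF f] le[OF g]] by (simp add: mode_energy_def sum.distrib distrib_left)
qed

section \<open>Summation over the frequencies\<close>

text \<open>
  For a decreasing \<open>w\<close> each term is at most \<open>n\<close> times the integral over the adjacent cell on the side of the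
  origin; the term at \<open>0\<close> has no such cell and stays outside.
\<close>
lemma symmetric_sum_le_integral:
  fixes w :: "real \<Rightarrow> real"
  assumes n: "0 < n" and cont: "continuous_on {0..R} w" and anti: "\<And>r s. 0 \<le> r \<Longrightarrow> r \<le> s \<Longrightarrow> s \<le> R \<Longrightarrow> w s \<le> w r"
  shows "real m / n \<le> R \<Longrightarrow> (\<Sum>k\<in>{- int m..int m}. w (\<bar>real_of_int k / n\<bar>)) \<le> w 0 + 2 * n * integral {0..real m / n} w"
proof (induction m)
  case (Suc m)
  let ?a = "real m / n" and ?b = "real (Suc m) / n"
  have ab: "0 \<le> ?a" "?a \<le> ?b" "?b \<le> R" "?b - ?a = 1 / n"
    using n Suc.prems by (auto simp: field_simps)
  have eq: "{- int (Suc m)..int (Suc m)} = insert (- int (Suc m)) (insert (int (Suc m)) {- int m..int m})"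
    by auto
  have "(\<Sum>k\<in>{- int (Suc m)..int (Suc m)}. w (\<bar>real_of_int k / n\<bar>))
      = 2 * w ?b + (\<Sum>k\<in>{- int m..int m}. w (\<bar>real_of_int k / n\<bar>))"
    unfolding eq using n by (simp add: abs_divide abs_minus_commute[of _ "real m"] add.commute)
  also have "\<dots> \<le> 2 * w ?b + (w 0 + 2 * n * integral {0..?a} w)"
    using Suc.IH ab by simp
  also have "w ?b \<le> n * integral {?a..?b} w"
  proof -
    have ion: "w integrable_on {?a..?b}"
      by (intro integrable_continuous_real continuous_on_subset[OF cont]) (use ab in auto)
    have "integral {?a..?b} (\<lambda>_. w ?b) \<le> integral {?a..?b} w"
      by (rule integral_le[OF _ ion]) (use ab anti in auto)
    then have "w ?b / n \<le> integral {?a..?b} w"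
      using ab n by (simp add: field_simps)
    then show ?thesis using n by (simp add: field_simps)
  qed
  also have "2 * (n * integral {?a..?b} w) + (w 0 + 2 * n * integral {0..?a} w)
     = w 0 + 2 * n * (integral {0..?a} w + integral {?a..?b} w)"
    by (simp add: algebra_simps)
  also have "integral {0..?a} w + integral {?a..?b} w = integral {0..?b} w"
    by (rule Henstock_Kurzweil_Integration.integral_combine)
      (use ab in \<open>auto intro!: integrable_continuous_real continuous_on_subset[OF cont]\<close>)
  finally show ?case by simp
qed simp

text \<open>
  Only an upper bound is needed, so the finite index set may be enlarged to all frequencies up to \<open>R\<close>.
\<close>
lemma low_frequency_sum_le:
  fixes w :: "real \<Rightarrow> real"
  assumes n: "0 < n" and R: "0 \<le> R" and cont: "continuous_on {0..R} w"
    and anti: "\<And>r s. 0 \<le> r \<Longrightarrow> r \<le> s \<Longrightarrow> s \<le> R \<Longrightarrow> w s \<le> w r"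
    and nonneg: "\<And>s. 0 \<le> s \<Longrightarrow> s \<le> R \<Longrightarrow> 0 \<le> w s"
    and S: "finite S" "\<And>k. k \<in> S \<Longrightarrow> \<bar>real_of_int k / n\<bar> \<le> R"
  shows "(\<Sum>k\<in>S. w (\<bar>real_of_int k / n\<bar>)) \<le> w 0 + 2 * n * integral {0..R} w"
proof -
  define m where "m = nat \<lfloor>n * R\<rfloor>"
  have "real m \<le> n * R" using n R by (simp add: m_def)
  then have mR: "real m / n \<le> R" using n by (simp add: field_simps)
  have "S \<subseteq> {- int m..int m}"
  proof
    fix k assume "k \<in> S"
    then have "\<bar>real_of_int k\<bar> \<le> n * R" using S(2) n by (simp add: field_simps)
    then have "\<bar>k\<bar> \<le> \<lfloor>n * R\<rfloor>" by linarith
    moreover have "0 \<le> n * R" using n R by simp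
    ultimately show "k \<in> {- int m..int m}" by (auto simp: m_def)
  qed
  moreover have "0 \<le> w \<bar>real_of_int k / n\<bar>" if "k \<in> {- int m..int m}" for k
  proof (rule nonneg)
    have "\<bar>real_of_int k\<bar> \<le> real m" using that by auto
    then have "\<bar>real_of_int k / n\<bar> \<le> real m / n" using n by (simp add: divide_right_mono)
    then show "\<bar>real_of_int k / n\<bar> \<le> R" using mR by simp
  qed simp
  ultimately have "(\<Sum>k\<in>S. w (\<bar>real_of_int k / n\<bar>)) \<le> (\<Sum>k\<in>{- int m..int m}. w (\<bar>real_of_int k / n\<bar>))"
    by (intro sum_mono2) auto
  also have "\<dots> \<le> w 0 + 2 * n * integral {0..real m / n} w"
    by (rule symmetric_sum_le_integral[OF n cont anti mR])
  also have "\<dots> \<le> w 0 + 2 * n * integral {0..R} w"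
    using n mR nonneg
    by (intro add_left_mono mult_left_mono integral_subset_le integrable_continuous_real continuous_on_subset[OF cont]) auto
  finally show ?thesis .
qed

text \<open>
  For \<open>n\<close> fixed, the three terms on the right come from the frequencies up to \<open>R\<close>, from those above \<open>R\<close>, and
  from the source that the cutoff creates. The summand \<open>1 / (2 \<pi> n)\<close> is the contribution of frequency \<open>0\<close>.
\<close>
lemma cutoff_solution_bound:
  fixes u v :: "real \<Rightarrow> real \<Rightarrow> real" and u0 v0 :: "real \<Rightarrow> real"
  assumes u0: "in_Lp 1 u0" "in_Lp 2 u0" and v0: "in_Lp 1 v0" "in_Lp 2 v0"
    and sol: "GT_solution u v u0 v0" and t: "0 \<le> t" and R: "0 < R" "R < 1/2"
    and n: "0 < n" and \<eta>: "0 < \<eta>" and M: "\<And>s. s \<in> {0..t} \<Longrightarrow> (LBINT x. (u s x)\<^sup>2 + (v s x)\<^sup>2) \<le> M"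
  shows "(1 - 2 * R) * (LBINT x. (cutoff n x * u t x)\<^sup>2 + (cutoff n x * v t x)\<^sup>2)
    \<le> exp (\<eta> * t) * (1 + 2 * R) *
      ((1 / (2 * pi * n) + integral {0..R} (\<lambda>s. exp (- 2 * mu s * t)) / pi) * (Lp_norm 1 (\<lambda>x. (u0 x, v0 x)))\<^sup>2
       + exp (- 2 * mu R * t) * (Lp_norm 2 (\<lambda>x. (u0 x, v0 x)))\<^sup>2
       + 1 / \<eta> * (t * ((4 / n)\<^sup>2 * M)))" (is "?lhs \<le> ?rhs")
proof (rule field_le_epsilon)
  fix e :: real assume e: "0 < e"
  have L2: "in_Lp 2 (u s)" "in_Lp 2 (v s)" if "0 \<le> s" for s
    using sol that by (auto simp: GT_solution_def)
  have init: "AE x in lborel. u 0 x = u0 x \<and> v 0 x = v0 x"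
    using sol by (simp add: GT_solution_def)
  define N where "N = 2 * pi * n"
  have N: "0 < N" using n by (simp add: N_def)
  define \<xi> where "\<xi> = (\<lambda>k. real_of_int k / n)"
  define Y where "Y = (\<lambda>k s. mode_energy (\<xi> k) (\<lambda>x. cutoff n x * u s x) (\<lambda>x. cutoff n x * v s x))"
  define G where "G = (\<lambda>k s. mode_energy (\<xi> k) (\<lambda>x. cutoff' n x * u s x) (\<lambda>x. cutoff' n x * v s x))"
  define w where "w = (\<lambda>s. exp (- 2 * mu s * t))"
  define J where "J = integral {0..R} w"
  define P1 where "P1 = (Lp_norm 1 (\<lambda>x. (u0 x, v0 x)))\<^sup>2"
  define P2 where "P2 = (LBINT x. (u0 x)\<^sup>2 + (v0 x)\<^sup>2)"
  have P2: "(Lp_norm 2 (\<lambda>x. (u0 x, v0 x)))\<^sup>2 = P2" by (simp add: P2_def Lp_norm_2_pair)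
  note cut = continuous_on_cutoff(1)[OF n, of UNIV] abs_cutoff_le
  note cut' = continuous_on_cutoff(2)[OF n, of UNIV] cutoff'_bound[OF n]
  have Ynn: "0 \<le> Y k s" for k s by (simp add: Y_def mode_energy_def)
  note cu = in_Lp_2_mult_bounded(1)[OF L2(1)[OF t] cut] in_Lp_2_mult_bounded(1)[OF L2(2)[OF t] cut]
  have e2: "0 < e / 2" using e by simp
  \<comment> \<open>The slack \<open>e\<close> pays for truncating the Fourier series of the two components at time \<open>t\<close>.\<close>
  obtain S1 where S1: "finite S1" "\<And>S. finite S \<Longrightarrow> S1 \<subseteq> S \<Longrightarrow> (LBINT x. (cutoff n x * u t x)\<^sup>2) \<le>
     e / 2 + (\<Sum>k\<in>S. (cos_transform (\<xi> k) (\<lambda>x. cutoff n x * u t x))\<^sup>2 + (sin_transform (\<xi> k) (\<lambda>x. cutoff n x * u t x))\<^sup>2) / N"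
    using parseval_le[of "\<lambda>x. cutoff n x * u t x" n, OF _ _ n _ e2] cu(1) cutoff_eq_0[OF n]
    unfolding in_Lp_2_iff N_def \<xi>_def by (metis (no_types, lifting) mult_zero_left)
  obtain S2 where S2: "finite S2" "\<And>S. finite S \<Longrightarrow> S2 \<subseteq> S \<Longrightarrow> (LBINT x. (cutoff n x * v t x)\<^sup>2) \<le>
     e / 2 + (\<Sum>k\<in>S. (cos_transform (\<xi> k) (\<lambda>x. cutoff n x * v t x))\<^sup>2 + (sin_transform (\<xi> k) (\<lambda>x. cutoff n x * v t x))\<^sup>2) / N"
    using parseval_le[of "\<lambda>x. cutoff n x * v t x" n, OF _ _ n _ e2] cu(2) cutoff_eq_0[OF n]
    unfolding in_Lp_2_iff N_def \<xi>_def by (metis (no_types, lifting) mult_zero_left)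
  define S where "S = S1 \<union> S2"
  have S: "finite S" using S1 S2 by (simp add: S_def)
  have "(LBINT x. (cutoff n x * u t x)\<^sup>2 + (cutoff n x * v t x)\<^sup>2)
     = (LBINT x. (cutoff n x * u t x)\<^sup>2) + (LBINT x. (cutoff n x * v t x)\<^sup>2)"
    using cu by (simp add: in_Lp_2_iff)
  also have "\<dots> \<le> e + (\<Sum>k\<in>S. Y k t) / N"
    using S1(2)[OF S] S2(2)[OF S] by (simp add: S_def Y_def mode_energy_def sum.distrib add_divide_distrib)
  finally have "?lhs \<le> (1 - 2 * R) * (e + (\<Sum>k\<in>S. Y k t) / N)"
    using R by (intro mult_left_mono) auto
  also have "\<dots> = (1 - 2 * R) * e + (\<Sum>k\<in>S. (1 - 2 * R) * Y k t) / N"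
    by (simp add: distrib_left sum_distrib_left)
  also have "(1 - 2 * R) * e \<le> 1 * e"
    using R e by (intro mult_right_mono) auto
  also have "(\<Sum>k\<in>S. (1 - 2 * R) * Y k t) \<le> (\<Sum>k\<in>S. exp (\<eta> * t) * (1 + 2 * R) *
      (w (min \<bar>\<xi> k\<bar> R) * Y k 0 + 1 / \<eta> * integral {0..t} (G k)))"
    unfolding Y_def G_def w_def by (intro sum_mono solution_mode_decay(2)[OF sol t n R \<eta>])
  also have "\<dots> = exp (\<eta> * t) * (1 + 2 * R) * ((\<Sum>k\<in>S. w (min \<bar>\<xi> k\<bar> R) * Y k 0) + 1 / \<eta> * (\<Sum>k\<in>S. integral {0..t} (G k)))"
    by (simp only: sum_distrib_left[symmetric] sum.distrib)
  also have "(\<Sum>k\<in>S. w (min \<bar>\<xi> k\<bar> R) * Y k 0) \<le> (1 + 2 * n * J) * P1 + w R * (N * P2)"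
  proof -
    define A where "A = {k \<in> S. \<bar>\<xi> k\<bar> \<le> R}"
    have A: "finite A" "A \<subseteq> S" using S by (auto simp: A_def)
    have contw: "continuous_on {0..R} w"
      unfolding w_def using R by (intro continuous_intros continuous_on_mu) auto
    have "(\<Sum>k\<in>S. w (min \<bar>\<xi> k\<bar> R) * Y k 0) = (\<Sum>k\<in>S - A. w R * Y k 0) + (\<Sum>k\<in>A. w \<bar>\<xi> k\<bar> * Y k 0)"
      unfolding sum.subset_diff[OF A(2) S] by (intro arg_cong2[where f="(+)"] sum.cong) (auto simp: A_def min_def)
    also have "(\<Sum>k\<in>A. w \<bar>\<xi> k\<bar> * Y k 0) \<le> (\<Sum>k\<in>A. w \<bar>\<xi> k\<bar> * P1)"
    proof (intro sum_mono mult_left_mono)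
      fix k
      have meas: "u 0 \<in> borel_measurable borel" "v 0 \<in> borel_measurable borel"
        "u0 \<in> borel_measurable borel" "v0 \<in> borel_measurable borel" "cutoff n \<in> borel_measurable borel"
        using L2[of 0] u0 v0 cut(1) by (auto simp: in_Lp_def intro: borel_measurable_continuous_onI)
      note [measurable] = meas
      have cong: "(LBINT x. cutoff n x * u 0 x * h x) = (LBINT x. cutoff n x * u0 x * h x)"
         "(LBINT x. cutoff n x * v 0 x * h x) = (LBINT x. cutoff n x * v0 x * h x)"
        if [measurable]: "h \<in> borel_measurable borel" for h
        by (rule integral_cong_AE; (measurable)?; use init in \<open>eventually_elim, simp\<close>)+
      have "Y k 0 = mode_energy (\<xi> k) (\<lambda>x. cutoff n x * u0 x) (\<lambda>x. cutoff n x * v0 x)"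
        unfolding Y_def mode_energy_def cos_transform_def sin_transform_def by (simp add: cong)
      also have "\<dots> \<le> P1"
        unfolding P1_def by (rule mode_energy_le_L1[OF u0(1) v0(1) cut])
      finally show "Y k 0 \<le> P1" .
    qed (simp add: w_def)
    also have "\<dots> = (\<Sum>k\<in>A. w \<bar>\<xi> k\<bar>) * P1" by (simp add: sum_distrib_right)
    also have "\<dots> \<le> (w 0 + 2 * n * J) * P1"
      unfolding J_def \<xi>_def
    proof (intro mult_right_mono low_frequency_sum_le[OF n _ contw])
      show "w s \<le> w r" if "0 \<le> r" "r \<le> s" "s \<le> R" for r s
        using mu_mono[of r s] that R t by (simp add: w_def mult_right_mono)
    qed (use A R in \<open>auto simp: A_def \<xi>_def w_def P1_def\<close>)
    also have "w 0 = 1" using mu_eq_sqrt[of 0] by (simp add: w_def real_sqrt_divide)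
    also have "(\<Sum>k\<in>S - A. w R * Y k 0) \<le> w R * (N * P2)"
    proof -
      have "(\<Sum>k\<in>S - A. Y k 0) \<le> 2 * pi * n * (1\<^sup>2 * (LBINT x. (u 0 x)\<^sup>2 + (v 0 x)\<^sup>2))"
        unfolding Y_def \<xi>_def using S L2[of 0] cutoff_eq_0[OF n] by (intro mode_energy_bessel cut n) auto
      also have "(LBINT x. (u 0 x)\<^sup>2 + (v 0 x)\<^sup>2) = P2"
        unfolding P2_def using L2[of 0] u0 v0 init
        by (intro integral_cong_AE) (auto simp: in_Lp_def)
      finally show ?thesis
        by (simp add: N_def w_def flip: sum_distrib_left)
    qed
    finally show ?thesis by simp
  qed
  also have "(\<Sum>k\<in>S. integral {0..t} (G k)) \<le> t * (N * ((4 / n)\<^sup>2 * M))"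
  proof -
    have Gc: "continuous_on {0..t} (G k)" for k
      unfolding G_def by (rule solution_mode_decay(1)[OF sol t n R \<eta>])
    have "(\<Sum>k\<in>S. integral {0..t} (G k)) = integral {0..t} (\<lambda>s. \<Sum>k\<in>S. G k s)"
      using S by (intro Henstock_Kurzweil_Integration.integral_sum[symmetric] integrable_continuous_real Gc)
    also have "\<dots> \<le> integral {0..t} (\<lambda>s. N * ((4 / n)\<^sup>2 * M))"
    proof (rule integral_le)
      show "(\<lambda>s. \<Sum>k\<in>S. G k s) integrable_on {0..t}"
        by (intro integrable_continuous_real continuous_intros Gc)
      fix s assume s: "s \<in> {0..t}"
      have "(\<Sum>k\<in>S. G k s) \<le> N * ((4 / n)\<^sup>2 * (LBINT x. (u s x)\<^sup>2 + (v s x)\<^sup>2))"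
        unfolding G_def \<xi>_def N_def using S L2[of s] s cutoff_eq_0[OF n] by (intro mode_energy_bessel cut' n) auto
      also have "\<dots> \<le> N * ((4 / n)\<^sup>2 * M)"
        using M[OF s] N by (intro mult_left_mono) auto
      finally show "(\<Sum>k\<in>S. G k s) \<le> N * ((4 / n)\<^sup>2 * M)" .
    qed (rule integrable_const_ivl)
    also have "\<dots> = t * (N * ((4 / n)\<^sup>2 * M))" using t by simp
    finally show ?thesis .
  qed
  finally have "?lhs \<le> 1 * e + exp (\<eta> * t) * (1 + 2 * R) *
      ((1 + 2 * n * J) * P1 + w R * (N * P2) + 1 / \<eta> * (t * (N * ((4 / n)\<^sup>2 * M)))) / N"
    using \<eta> R N by (simp add: add_mono mult_left_mono divide_right_mono)
  also have "exp (\<eta> * t) * (1 + 2 * R) *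
      ((1 + 2 * n * J) * P1 + w R * (N * P2) + 1 / \<eta> * (t * (N * ((4 / n)\<^sup>2 * M)))) / N
     = exp (\<eta> * t) * (1 + 2 * R) *
      (((1 + 2 * n * J) * P1 + w R * (N * P2) + 1 / \<eta> * (t * (N * ((4 / n)\<^sup>2 * M)))) / N)"
    by simp
  also have "((1 + 2 * n * J) * P1 + w R * (N * P2) + 1 / \<eta> * (t * (N * ((4 / n)\<^sup>2 * M)))) / N
     = (1 / N + J / pi) * P1 + w R * P2 + 1 / \<eta> * (t * ((4 / n)\<^sup>2 * M))"
  proof -
    have "(1 + 2 * n * J) / N = 1 / N + J / pi"
      using n by (simp add: N_def add_divide_distrib)
    then have "(1 + 2 * n * J) * P1 / N = (1 / N + J / pi) * P1"
      by (metis times_divide_eq_left)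
    then show ?thesis using N by (simp add: add_divide_distrib)
  qed
  finally show "?lhs \<le> ?rhs + e"
    unfolding P2 unfolding N_def J_def w_def P1_def by simp
qed

text \<open>
  First \<open>n \<rightarrow> \<infinity>\<close> removes the cutoff and its source, then \<open>\<eta> \<rightarrow> 0\<close> restores the decay rate. The order matters
  because the source is divided by \<open>\<eta>\<close>.
\<close>
lemma solution_L2_bound:
  fixes u v :: "real \<Rightarrow> real \<Rightarrow> real" and u0 v0 :: "real \<Rightarrow> real"
  assumes u0: "in_Lp 1 u0" "in_Lp 2 u0" and v0: "in_Lp 1 v0" "in_Lp 2 v0"
    and sol: "GT_solution u v u0 v0" and t: "0 \<le> t" and R: "0 < R" "R < 1/2"
  shows "(1 - 2 * R) * (Lp_norm 2 (\<lambda>x. (u t x, v t x)))\<^sup>2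
    \<le> (1 + 2 * R) *
      (integral {0..R} (\<lambda>s. exp (- 2 * mu s * t)) / pi * (Lp_norm 1 (\<lambda>x. (u0 x, v0 x)))\<^sup>2
       + exp (- 2 * mu R * t) * (Lp_norm 2 (\<lambda>x. (u0 x, v0 x)))\<^sup>2)"
proof -
  define J where "J = integral {0..R} (\<lambda>s. exp (- 2 * mu s * t))"
  define P1 where "P1 = (Lp_norm 1 (\<lambda>x. (u0 x, v0 x)))\<^sup>2"
  define Q where "Q = exp (- 2 * mu R * t) * (Lp_norm 2 (\<lambda>x. (u0 x, v0 x)))\<^sup>2"
  define E where "E = (Lp_norm 2 (\<lambda>x. (u t x, v t x)))\<^sup>2"
  obtain M where M: "\<And>s. s \<in> {0..t} \<Longrightarrow> (LBINT x. (u s x)\<^sup>2 + (v s x)\<^sup>2) \<le> M"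
    using solution_energy_bounded[OF sol] by blast
  have L2: "in_Lp 2 (u t)" "in_Lp 2 (v t)"
    using sol t by (auto simp: GT_solution_def)
  define n where "n = (\<lambda>j. real (Suc j))"
  have n: "0 < n j" for j by (simp add: n_def)
  have limE: "(\<lambda>j. LBINT x. (cutoff (n j) x * u t x)\<^sup>2 + (cutoff (n j) x * v t x)\<^sup>2) \<longlonglongrightarrow> E"
    unfolding E_def Lp_norm_2_pair
  proof (rule integral_dominated_convergence[where w="\<lambda>x. (u t x)\<^sup>2 + (v t x)\<^sup>2"])
    have [measurable]: "u t \<in> borel_measurable borel" "v t \<in> borel_measurable borel" "cutoff (n j) \<in> borel_measurable borel" for j
      using L2 continuous_on_cutoff(1)[OF n, of UNIV] by (auto simp: in_Lp_def intro: borel_measurable_continuous_onI)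
    show "(\<lambda>x. (u t x)\<^sup>2 + (v t x)\<^sup>2) \<in> borel_measurable lborel" by measurable
    show "(\<lambda>x. (cutoff (n j) x * u t x)\<^sup>2 + (cutoff (n j) x * v t x)\<^sup>2) \<in> borel_measurable lborel" for j by measurable
    show "integrable lborel (\<lambda>x. (u t x)\<^sup>2 + (v t x)\<^sup>2)" using L2 by (simp add: in_Lp_2_iff)
    show "AE x in lborel. (\<lambda>j. (cutoff (n j) x * u t x)\<^sup>2 + (cutoff (n j) x * v t x)\<^sup>2) \<longlonglongrightarrow> (u t x)\<^sup>2 + (v t x)\<^sup>2"
    proof (rule AE_I2)
      fix x
      have "(\<lambda>j. (cutoff (n j) x * u t x)\<^sup>2 + (cutoff (n j) x * v t x)\<^sup>2) \<longlonglongrightarrow> (1 * u t x)\<^sup>2 + (1 * v t x)\<^sup>2"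
        unfolding n_def by (intro tendsto_intros cutoff_tendsto_1)
      then show "(\<lambda>j. (cutoff (n j) x * u t x)\<^sup>2 + (cutoff (n j) x * v t x)\<^sup>2) \<longlonglongrightarrow> (u t x)\<^sup>2 + (v t x)\<^sup>2" by simp
    qed
    have "(cutoff (n j) x * z)\<^sup>2 \<le> z\<^sup>2" for j x z
      using cutoff_bounds[of "n j" x] by (simp add: power_mult_distrib mult_left_le_one_le power_le_one)
    then show "AE x in lborel. norm ((cutoff (n j) x * u t x)\<^sup>2 + (cutoff (n j) x * v t x)\<^sup>2) \<le> (u t x)\<^sup>2 + (v t x)\<^sup>2" for j
      by (intro AE_I2) (simp add: add_mono)
  qed
  have lim0: "(\<lambda>j. 1 / n j) \<longlonglongrightarrow> 0"
    using LIMSEQ_inverse_real_of_nat by (simp add: n_def inverse_eq_divide)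
  have bound: "(1 - 2 * R) * E \<le> exp (\<eta> * t) * (1 + 2 * R) * (J / pi * P1 + Q)" if \<eta>: "0 < \<eta>" for \<eta>
  proof (rule LIMSEQ_le)
    show "(\<lambda>j. (1 - 2 * R) * (LBINT x. (cutoff (n j) x * u t x)\<^sup>2 + (cutoff (n j) x * v t x)\<^sup>2)) \<longlonglongrightarrow> (1 - 2 * R) * E"
      by (intro tendsto_intros limE)
    have "(\<lambda>j. exp (\<eta> * t) * (1 + 2 * R) * ((1 / n j * (1 / (2 * pi)) + J / pi) * P1 + Q + 1 / \<eta> * (t * ((4 * (1 / n j))\<^sup>2 * M))))
       \<longlonglongrightarrow> exp (\<eta> * t) * (1 + 2 * R) * ((0 * (1 / (2 * pi)) + J / pi) * P1 + Q + 1 / \<eta> * (t * ((4 * 0)\<^sup>2 * M)))"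
      by (intro tendsto_intros lim0)
    then show "(\<lambda>j. exp (\<eta> * t) * (1 + 2 * R) * ((1 / (2 * pi * n j) + J / pi) * P1 + Q + 1 / \<eta> * (t * ((4 / n j)\<^sup>2 * M))))
       \<longlonglongrightarrow> exp (\<eta> * t) * (1 + 2 * R) * (J / pi * P1 + Q)"
      by (simp add: mult_ac)
    show "\<exists>N. \<forall>j\<ge>N. (1 - 2 * R) * (LBINT x. (cutoff (n j) x * u t x)\<^sup>2 + (cutoff (n j) x * v t x)\<^sup>2)
        \<le> exp (\<eta> * t) * (1 + 2 * R) * ((1 / (2 * pi * n j) + J / pi) * P1 + Q + 1 / \<eta> * (t * ((4 / n j)\<^sup>2 * M)))"
      unfolding J_def P1_def Q_def
      by (intro exI[of _ 0] allI impI cutoff_solution_bound[OF u0 v0 sol t R n \<eta> M])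
  qed
  have "((\<lambda>\<eta>. exp (\<eta> * t) * (1 + 2 * R) * (J / pi * P1 + Q)) \<longlongrightarrow> exp (0 * t) * (1 + 2 * R) * (J / pi * P1 + Q)) (at_right 0)"
    by (intro tendsto_intros)
  then have "(1 - 2 * R) * E \<le> exp (0 * t) * (1 + 2 * R) * (J / pi * P1 + Q)"
  proof (rule tendsto_lowerbound)
    show "\<forall>\<^sub>F \<eta> in at_right 0. (1 - 2 * R) * E \<le> exp (\<eta> * t) * (1 + 2 * R) * (J / pi * P1 + Q)"
      using bound by (auto simp: eventually_at_filter)
  qed simp
  then show ?thesis
    by (simp add: E_def J_def P1_def Q_def)
qed

theorem proposition5:
  fixes u v :: "real \<Rightarrow> real \<Rightarrow> real" and u0 v0 :: "real \<Rightarrow> real" and t :: real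
  assumes "in_Lp 1 u0" and "in_Lp 2 u0"
    and "in_Lp 1 v0" and "in_Lp 2 v0"
    and "GT_solution u v u0 v0"
    and "t \<ge> 0"
  shows "(Lp_norm 2 (\<lambda>x. (u t x, v t x)))\<^sup>2
           \<le> (INF R\<in>{0<..<1/2}. (1 + 2 * R) / (1 - 2 * R) *
                (2 * min (B_quot t R) R * (Lp_norm 1 (\<lambda>x. (u0 x, v0 x)))\<^sup>2
                 + exp (- 2 * mu R * t) * (Lp_norm 2 (\<lambda>x. (u0 x, v0 x)))\<^sup>2))
         \<and> (\<forall>R\<in>{0<..<1/2}. B t R \<in> {0..<sqrt (pi / 8)})"
proof
  show "\<forall>R\<in>{0<..<1/2}. B t R \<in> {0..<sqrt (pi / 8)}"
    using B_bounds assms(6) by simp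
  show "(Lp_norm 2 (\<lambda>x. (u t x, v t x)))\<^sup>2
           \<le> (INF R\<in>{0<..<1/2}. (1 + 2 * R) / (1 - 2 * R) *
                (2 * min (B_quot t R) R * (Lp_norm 1 (\<lambda>x. (u0 x, v0 x)))\<^sup>2
                 + exp (- 2 * mu R * t) * (Lp_norm 2 (\<lambda>x. (u0 x, v0 x)))\<^sup>2))"
  proof (rule cINF_greatest)
    fix R :: real assume "R \<in> {0<..<1/2}"
    then have R: "0 < R" "R < 1/2" by auto
    let ?E = "(Lp_norm 2 (\<lambda>x. (u t x, v t x)))\<^sup>2" and ?P = "(Lp_norm 1 (\<lambda>x. (u0 x, v0 x)))\<^sup>2"
      and ?Q = "exp (- 2 * mu R * t) * (Lp_norm 2 (\<lambda>x. (u0 x, v0 x)))\<^sup>2"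
    have q: "0 \<le> B_quot t R" "B_quot t R \<le> R"
      using B_quot_bounds[of t R] assms(6) R by auto
    have "(1 - 2 * R) * ?E \<le> (1 + 2 * R) * (B_quot t R / pi * ?P + ?Q)"
      using solution_L2_bound[OF assms R] B_quot_eq_integral[of t R] assms(6) R by simp
    also have "\<dots> \<le> (1 + 2 * R) * (2 * min (B_quot t R) R * ?P + ?Q)"
    proof (intro mult_left_mono add_right_mono mult_right_mono)
      \<comment> \<open>Here the factor \<open>2 \<pi>\<close> between the two constants is given away.\<close>
      have "B_quot t R / pi \<le> B_quot t R / 1"
        using q pi_gt3 by (intro divide_left_mono) auto
      then show "B_quot t R / pi \<le> 2 * min (B_quot t R) R" using q by simp
    qed (use R in auto)
    finally show "?E \<le> (1 + 2 * R) / (1 - 2 * R) * (2 * min (B_quot t R) R * ?P + ?Q)"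
      using R by (simp add: pos_le_divide_eq mult.commute)
  qed simp
qed

end
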